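(* For every integer $d \geq 1$, the cone \[ \Gamma^d = \left\{ (\xi_1, \dotsc, \xi_d, \xi_{d+1}) \in \mathbb{R}^{d+1} : \lvert (\xi_1, \dotsc, \xi_d) \rvert = \lvert \xi_{d+1} \rvert \right\} \] satisfies $\dim_F \Gamma^d = d-1$.
   Context: $\lvert\cdot\rvert$ is the Euclidean norm. For a Borel probability measure $\mu$ on $\mathbb{R}^{n}$, $\widehat{\mu}(\xi) = \int e^{-2\pi i \langle \xi, x\rangle}\, d\mu(x)$. For $A \subseteq \mathbb{R}^{n}$, let $\mathcal{P}(A)$ be the set of Borel probability measures $\mu$ on $\mathbb{R}^{n}$ with $\mu(A)=1$. The Fourier dimension of $A$ is \[ \dim_F A = \sup\left\{ s \in [0,n] : \exists \mu \in \mathcal{P}(A) \text{ and } C>0 \text{ such that } \lvert \widehat{\mu}(\xi)\rvert \leq C \lvert \xi\rvert^{-s/2} \text{ for all } \xi \in \mathbb{R}^{n}\setminus\{0\} \right\}. \] Here $n = d+1$. *)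

theory Defs
  imports "HOL-Probability.Probability"
begin

definition borel_prob_on :: "'a::euclidean_space set \<Rightarrow> 'a measure set" where
  "borel_prob_on A = {M. prob_space M \<and> sets M = sets borel \<and> A \<in> sets M \<and> emeasure M A = 1}"

definition fourier_transform :: "'a::euclidean_space measure \<Rightarrow> 'a \<Rightarrow> complex" where
  "fourier_transform M \<xi> = (LINT x|M. cis (- 2 * pi * (\<xi> \<bullet> x)))"

definition fourier_dim :: "'a::euclidean_space set \<Rightarrow> real" where
  "fourier_dim A = Sup {s. 0 \<le> s \<and> s \<le> real DIM('a) \<and>
     (\<exists>M \<in> borel_prob_on A. \<exists>C>0. \<forall>\<xi>. \<xi> \<noteq> 0 \<longrightarrow>
        norm (fourier_transform M \<xi>) \<le> C * norm \<xi> powr (- s / 2))}"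

definition light_cone :: "('a::euclidean_space \<times> real) set" where
  "light_cone = {(x, t). norm x = \<bar>t\<bar>}"

end

theory Submission
  imports Defs "HOL-Complex_Analysis.Complex_Analysis"
begin

text \<open>
  Upper bound: pair \<^term>\<open>fourier_transform \<mu> (R *\<^sub>R \<eta>)\<close> with a Gaussian in \<open>\<eta> = (\<xi>, \<tau>)\<close> times a
  weight of the form \<open>W (R * (\<bar>\<xi>\<bar>\<^sup>2 - \<tau>\<^sup>2))\<close>, where \<open>W\<close> is the characteristic function of a Gamma law. Writing \<open>W\<close> as
  an average of \<open>cis (R * \<sigma> * (\<bar>\<xi>\<bar>\<^sup>2 - \<tau>\<^sup>2))\<close> over \<open>\<sigma> > 0\<close>, Fubini turns the pairing into an integral against \<open>\<mu>\<close> of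
  complex Gaussians, which on the cone do not oscillate and, multiplied by \<open>R\<^bsup>(d+1)/2\<^esup>\<close>, converge to a fixed
  complex number times a strictly positive function. On the other hand the test function lives near the
  dual cone, so decay of order \<open>s/2\<close> with \<open>s > d - 1\<close> makes the pairing \<open>o(R\<^bsup>-(d+1)/2\<^esup>)\<close>.

  Lower bound: the cone is swept out by \<open>u (2p, \<bar>p\<bar>\<^sup>2 - 1, \<bar>p\<bar>\<^sup>2 + 1)\<close>. With \<open>p\<close> Gaussian and \<open>u\<close> Gamma distributed, the
  \<open>p\<close>-integral is an explicit Gaussian giving the decay from the \<open>d - 1\<close> curvatures, and the \<open>u\<close>-integral is
  explicit and gives fast decay in the directions that are not nearly normal to the cone. Interpolating
  the two gives every exponent below \<open>d - 1\<close>.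
\<close>

section \<open>Laplace transforms of complex weights\<close>

text \<open>A non-integrable \<open>f\<close> is covered as well: its integral is 0 by convention,
  and the bound makes \<open>g\<close> nonnegative almost everywhere.\<close>

lemma norm_integral_le_AE:
  fixes f :: "'a \<Rightarrow> 'b::{banach, second_countable_topology}"
  assumes g: "integrable M g" and le: "AE x in M. norm (f x) \<le> g x"
  shows "norm (integral\<^sup>L M f) \<le> integral\<^sup>L M g"
proof (cases "integrable M f")
  case True
  have "norm (integral\<^sup>L M f) \<le> (LINT x|M. norm (f x))" by simp
  also have "\<dots> \<le> integral\<^sup>L M g"
    using integrable_norm[OF True] g le by (rule integral_mono_AE)
  finally show ?thesis .
next
  case False
  have "AE x in M. 0 \<le> g x" using le by eventually_elim (rule order_trans[OF norm_ge_zero])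
  then show ?thesis using False by (simp add: not_integrable_integral_eq integral_nonneg_AE)
qed

lemma norm_integral_le:
  fixes f :: "'a \<Rightarrow> 'b::{banach, second_countable_topology}"
  assumes "integrable M g" and "\<And>x. norm (f x) \<le> g x"
  shows "norm (integral\<^sup>L M f) \<le> integral\<^sup>L M g"
  using assms by (intro norm_integral_le_AE) auto

lemma norm_exp_minus_one_minus_le:
  "norm (exp w - 1 - w) \<le> exp (norm w) * (norm w)\<^sup>2" for w :: complex
  using Taylor_exp_field[of w 1] by (simp add: power2_eq_square algebra_simps)

text \<open>The quadratic Taylor term of \<open>exp (r * q / 4)\<close> is
  \<open>(r * q)\<^sup>2 / 32\<close>. This trades a factor \<open>q\<^sup>2\<close> for a quarter
  of the decay rate \<open>r\<close>.\<close>

lemma square_le_exp_scaled: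
  fixes q r :: real
  assumes "0 \<le> q" "0 < r"
  shows "q\<^sup>2 \<le> 32 / r\<^sup>2 * exp (r * q / 4)"
proof -
  have "(r * q / 4)\<^sup>2 / 2 \<le> exp (r * q / 4)"
    using exp_lower_Taylor_quadratic[of "r * q / 4"] assms by (smt (verit) divide_nonneg_nonneg mult_nonneg_nonneg)
  with assms show ?thesis by (simp add: field_simps power2_eq_square)
qed

text \<open>The first-order Taylor expansion of the exponential is integrated with an explicit
  quadratic remainder, so the difference quotients converge to \<open>D\<close> at a linear
  rate.\<close>

lemma laplace_transform_holomorphic:
  fixes c :: "'a \<Rightarrow> complex" and q :: "'a \<Rightarrow> real"
  assumes [measurable]: "c \<in> borel_measurable M" "q \<in> borel_measurable M"
    and q: "\<And>x. 0 \<le> q x"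
    and int: "\<And>r. 0 < r \<Longrightarrow> integrable M (\<lambda>x. c x * of_real (exp (- r * q x)))"
  shows "(\<lambda>z. LINT x|M. c x * exp (- z * of_real (q x))) holomorphic_on {z. 0 < Re z}"
proof -
  have int_c: "integrable M (\<lambda>x. norm (c x) * exp (- r * q x))" if "0 < r" for r
    using integrable_norm[OF int[OF that]] by (simp add: norm_mult)
  have int_z: "integrable M (\<lambda>x. c x * exp (- z * of_real (q x)))" if "0 < Re z" for z
    by (rule Bochner_Integration.integrable_bound[OF int_c[OF that]])
       (simp_all add: norm_mult norm_exp_eq_Re)
  have "(\<lambda>z. LINT x|M. c x * exp (- z * of_real (q x))) field_differentiable (at z0)" if z0: "0 < Re z0" for z0
  proof -
    define r where "r = Re z0"
    have r: "0 < r" using z0 by (simp add: r_def)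
    define D where "D = (LINT x|M. c x * exp (- z0 * of_real (q x)) * (- of_real (q x)))"
    \<comment> \<open>Of the decay rate \<open>r\<close>, the factor \<open>exp (norm w)\<close>
      costs \<open>r / 2\<close> when \<open>norm (z - z0) < r / 2\<close>, and the square costs
      \<open>r / 4\<close>; the rate \<open>r / 4\<close> survives.\<close>
    define K where "K = (LINT x|M. 32 / r\<^sup>2 * (norm (c x) * exp (- (r / 4) * q x)))"
    have intD: "integrable M (\<lambda>x. c x * exp (- z0 * of_real (q x)) * (- of_real (q x)))"
    proof (rule Bochner_Integration.integrable_bound)
      \<comment> \<open>The single factor \<open>q x\<close> costs a quarter of the rate
        \<open>r\<close>, leaving \<open>3 * r / 4\<close>.\<close>
      show "integrable M (\<lambda>x. 4 / r * (norm (c x) * exp (- (3 * r / 4) * q x)))"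
        using int_c[of "3 * r / 4"] r by simp
      show "AE x in M. norm (c x * exp (- z0 * of_real (q x)) * (- of_real (q x)))
              \<le> norm (4 / r * (norm (c x) * exp (- (3 * r / 4) * q x)))"
      proof (rule AE_I2)
        fix x
        have "r * q x / 4 \<le> exp (r * q x / 4)"
          using exp_ge_add_one_self[of "r * q x / 4"] by linarith
        then have "q x \<le> 4 / r * exp (r * q x / 4)" using r by (simp add: field_simps)
        then have "exp (- r * q x) * q x \<le> exp (- r * q x) * (4 / r * exp (r * q x / 4))"
          by (intro mult_left_mono) auto
        also have "\<dots> = 4 / r * exp (- (3 * r / 4) * q x)"
          by (simp add: exp_add[symmetric] field_simps)
        finally have "norm (c x) * (exp (- r * q x) * q x) \<le> norm (c x) * (4 / r * exp (- (3 * r / 4) * q x))"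
          by (intro mult_left_mono) auto
        then show "norm (c x * exp (- z0 * of_real (q x)) * (- of_real (q x)))
              \<le> norm (4 / r * (norm (c x) * exp (- (3 * r / 4) * q x)))"
          using r q[of x] by (simp add: norm_mult norm_exp_eq_Re r_def mult_ac)
      qed
    qed simp
    have quad: "norm ((LINT x|M. c x * exp (- z * of_real (q x))) - (LINT x|M. c x * exp (- z0 * of_real (q x))) - D * (z - z0))
        \<le> K * (norm (z - z0))\<^sup>2" if z: "norm (z - z0) < r / 2" for z
    proof -
      have "\<bar>Re z - Re z0\<bar> < r / 2"
        using z abs_Re_le_cmod[of "z - z0"] by simp
      then have "0 < Re z" using r unfolding r_def by arith
      note ints = int_z[OF this] int_z[OF z0] intD
      have "norm ((LINT x|M. c x * exp (- z * of_real (q x))) - (LINT x|M. c x * exp (- z0 * of_real (q x))) - D * (z - z0))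
         = norm (LINT x|M. c x * exp (- z * of_real (q x)) - c x * exp (- z0 * of_real (q x)) - c x * exp (- z0 * of_real (q x)) * (- of_real (q x)) * (z - z0))"
        unfolding D_def using ints by simp
      also have "\<dots> \<le> (LINT x|M. (norm (z - z0))\<^sup>2 * (32 / r\<^sup>2 * (norm (c x) * exp (- (r / 4) * q x))))"
      proof (rule norm_integral_le)
        show "integrable M (\<lambda>x. (norm (z - z0))\<^sup>2 * (32 / r\<^sup>2 * (norm (c x) * exp (- (r / 4) * q x))))"
          using int_c[of "r / 4"] r by (intro integrable_mult_right) auto
        fix x
        define w where "w = - (z - z0) * of_real (q x)"
        have nw: "norm w = norm (z - z0) * q x" unfolding w_def norm_mult norm_minus_cancel using q[of x] by simp
        have "exp (- z * of_real (q x)) = exp (- z0 * of_real (q x)) * exp w"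
          by (simp add: w_def exp_add[symmetric] algebra_simps)
        then have "c x * exp (- z * of_real (q x)) - c x * exp (- z0 * of_real (q x)) - c x * exp (- z0 * of_real (q x)) * (- of_real (q x)) * (z - z0)
            = c x * exp (- z0 * of_real (q x)) * (exp w - 1 - w)"
          by (simp add: w_def algebra_simps)
        then have "norm (c x * exp (- z * of_real (q x)) - c x * exp (- z0 * of_real (q x)) - c x * exp (- z0 * of_real (q x)) * (- of_real (q x)) * (z - z0))
            = norm (c x) * exp (- r * q x) * norm (exp w - 1 - w)"
          by (simp add: norm_mult norm_exp_eq_Re r_def)
        also have "\<dots> \<le> norm (c x) * exp (- r * q x) * (exp (r / 2 * q x) * ((norm (z - z0))\<^sup>2 * (32 / r\<^sup>2 * exp (r * q x / 4))))"
        proof (rule mult_left_mono)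
          have "norm (exp w - 1 - w) \<le> exp (norm w) * (norm w)\<^sup>2" by (rule norm_exp_minus_one_minus_le)
          also have "\<dots> \<le> exp (r / 2 * q x) * ((norm (z - z0))\<^sup>2 * (32 / r\<^sup>2 * exp (r * q x / 4)))"
            unfolding nw power_mult_distrib
            using mult_right_mono[OF less_imp_le[OF z] q[of x]] square_le_exp_scaled[OF q[of x] r]
            by (intro mult_mono) (auto intro!: mult_right_mono mult_left_mono)
          finally show "norm (exp w - 1 - w) \<le> exp (r / 2 * q x) * ((norm (z - z0))\<^sup>2 * (32 / r\<^sup>2 * exp (r * q x / 4)))" .
        qed auto
        also have "\<dots> = (norm (z - z0))\<^sup>2 * (32 / r\<^sup>2 * (norm (c x) * (exp (- r * q x) * exp (r / 2 * q x) * exp (r * q x / 4))))"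
          by (simp add: mult_ac)
        also have "exp (- r * q x) * exp (r / 2 * q x) * exp (r * q x / 4) = exp (- (r / 4) * q x)"
          unfolding exp_add[symmetric] by (simp add: field_simps)
        finally show "norm (c x * exp (- z * of_real (q x)) - c x * exp (- z0 * of_real (q x)) - c x * exp (- z0 * of_real (q x)) * (- of_real (q x)) * (z - z0))
          \<le> (norm (z - z0))\<^sup>2 * (32 / r\<^sup>2 * (norm (c x) * exp (- (r / 4) * q x)))" .
      qed
      also have "\<dots> = K * (norm (z - z0))\<^sup>2" unfolding K_def integral_mult_right_zero by (rule mult.commute)
      finally show ?thesis .
    qed
    let ?F = "\<lambda>z. LINT x|M. c x * exp (- z * of_real (q x))"
    have K0: "0 \<le> K" unfolding K_def by (rule Bochner_Integration.integral_nonneg) simp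
    have "((\<lambda>z. (?F z - ?F z0) / (z - z0) - D) \<longlongrightarrow> 0) (at z0)"
    proof (rule Lim_null_comparison)
      show "\<forall>\<^sub>F z in at z0. norm ((?F z - ?F z0) / (z - z0) - D) \<le> K * norm (z - z0)"
        unfolding eventually_at
      proof (intro exI[of _ "r/2"] conjI ballI impI)
        fix z assume "z \<noteq> z0 \<and> dist z z0 < r / 2"
        then have nz: "z - z0 \<noteq> 0" and "norm (z - z0) < r / 2" by (auto simp: dist_norm)
        from quad[OF this(2)] have "norm ((?F z - ?F z0) - D * (z - z0)) / norm (z - z0) \<le> K * norm (z - z0)"
          using nz by (simp add: field_simps power2_eq_square)
        also have "norm ((?F z - ?F z0) - D * (z - z0)) / norm (z - z0) = norm ((?F z - ?F z0) / (z - z0) - D)"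
          using nz by (simp add: norm_divide[symmetric] diff_divide_distrib)
        finally show "norm ((?F z - ?F z0) / (z - z0) - D) \<le> K * norm (z - z0)" .
      qed (use r in auto)
      show "((\<lambda>z. K * norm (z - z0)) \<longlongrightarrow> 0) (at z0)"
        by (intro tendsto_eq_intros | simp)+
    qed
    then have "(?F has_field_derivative D) (at z0)"
      unfolding has_field_derivative_iff using Lim_null by blast
    then show ?thesis by (auto simp: field_differentiable_def)
  qed
  then show ?thesis
    by (auto simp: holomorphic_on_def intro: field_differentiable_at_within)
qed

lemma halfplane_identity_theorem:
  assumes f: "f holomorphic_on {z. 0 < Re z}" and g: "g holomorphic_on {z. 0 < Re z}"
    and eq: "\<And>r. 0 < r \<Longrightarrow> f (complex_of_real r) = g (complex_of_real r)"
    and z: "0 < Re z"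
  shows "f z = g z"
proof -
  have "f z - g z = 0"
  \<comment> \<open>The positive reals accumulate at 1, inside the half-plane, so agreement there
    determines the function.\<close>
  proof (rule analytic_continuation[of "\<lambda>z. f z - g z" "{z. 0 < Re z}" "of_real ` {0<..}" 1])
    show "(\<lambda>z. f z - g z) holomorphic_on {z. 0 < Re z}" by (intro holomorphic_intros f g)
    show "open {z. 0 < Re z}" by (rule open_halfspace_Re_gt)
    show "connected {z. 0 < Re z}" by (rule convex_connected[OF convex_halfspace_Re_gt])
    have "(1::real) islimpt {0<..}" by (intro interior_limit_point) (simp add: interior_open)
    then show "(1::complex) islimpt of_real ` {0::real<..}"
      using islimpt_isCont_image[of 1 "{0<..}" complex_of_real]
      by (auto simp: eventually_at_filter)
  qed (use eq z in auto)
  then show ?thesis by simp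
qed

text \<open>A formula known for real rates \<open>r\<close> extends to complex rates by analytic
  continuation. It is applied to Gaussian integrals of complex variance and to Gamma integrals of
  complex rate.\<close>

lemma laplace_transform_eqI:
  fixes c :: "'a \<Rightarrow> complex" and q :: "'a \<Rightarrow> real"
  assumes "c \<in> borel_measurable M" "q \<in> borel_measurable M" "\<And>x. 0 \<le> q x"
    and "\<And>r. 0 < r \<Longrightarrow> integrable M (\<lambda>x. c x * of_real (exp (- r * q x)))"
    and "g holomorphic_on {z. 0 < Re z}"
    and eq: "\<And>r. 0 < r \<Longrightarrow> (LINT x|M. c x * of_real (exp (- r * q x))) = g (of_real r)"
    and z: "0 < Re z"
  shows "(LINT x|M. c x * exp (- z * of_real (q x))) = g z"
  using laplace_transform_holomorphic[OF assms(1-4)] assms(5) _ z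
proof (rule halfplane_identity_theorem)
  fix r :: real assume "0 < r"
  from eq[OF this] show "(LINT x|M. c x * exp (- complex_of_real r * complex_of_real (q x))) = g (complex_of_real r)"
    by (simp add: exp_of_real[symmetric])
qed

section \<open>Gaussian and Gamma measures\<close>

text \<open>For real \<open>\<zeta>\<close>, rescaling by its square root reduces to the
  characteristic function of the standard normal law. Both sides are holomorphic in
  \<open>\<zeta>\<close> because the right half-plane avoids the branch cut of
  \<open>csqrt\<close>.\<close>

lemma lborel_integral_gaussian_complex:
  fixes \<zeta> :: complex and \<xi> :: real
  assumes "0 < Re \<zeta>"
  shows "(LINT x|lborel. iexp (\<xi> * x) / of_real (sqrt (2 * pi)) * exp (- \<zeta> * of_real (x\<^sup>2 / 2)))
    = exp (- (of_real \<xi>)\<^sup>2 / (2 * \<zeta>)) / csqrt \<zeta>"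
proof (rule laplace_transform_eqI[where g = "\<lambda>\<zeta>. exp (- (of_real \<xi>)\<^sup>2 / (2 * \<zeta>)) / csqrt \<zeta>"])
  have std: "iexp (\<xi> * x) / of_real (sqrt (2 * pi)) * of_real (exp (- r * (x\<^sup>2 / 2)))
      = std_normal_density (sqrt r * x) *\<^sub>R iexp (\<xi> / sqrt r * (sqrt r * x))" if "0 < r" for x r
    using that by (simp add: std_normal_density_def scaleR_conv_of_real power_mult_distrib)
  have int0: "integrable lborel (\<lambda>x. std_normal_density x *\<^sub>R iexp (t * x))" for t
    by (rule Bochner_Integration.integrable_bound[OF integrable_normal_moment[of 1 0 0]]) auto
  fix r :: real assume r: "0 < r"
  show "integrable lborel (\<lambda>x. iexp (\<xi> * x) / of_real (sqrt (2 * pi)) * of_real (exp (- r * (x\<^sup>2 / 2))))"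
    unfolding std[OF r] using lborel_integrable_real_affine[OF int0[of "\<xi> / sqrt r"], of "sqrt r" 0] r by simp
  have "(LINT x|lborel. iexp (\<xi> * x) / of_real (sqrt (2 * pi)) * of_real (exp (- r * (x\<^sup>2 / 2))))
      = (1 / sqrt r) *\<^sub>R (LINT x|lborel. std_normal_density x *\<^sub>R iexp (\<xi> / sqrt r * x))"
    unfolding std[OF r]
    using lborel_integral_real_affine[of "sqrt r" "\<lambda>x. std_normal_density x *\<^sub>R iexp (\<xi> / sqrt r * x)" 0] r
    by simp
  also have "(LINT x|lborel. std_normal_density x *\<^sub>R iexp (\<xi> / sqrt r * x)) = char std_normal_distribution (\<xi> / sqrt r)"
    unfolding char_def by (subst integral_density) (auto simp: scaleR_conv_of_real mult_ac)
  also have "\<dots> = of_real (exp (- (\<xi>\<^sup>2 / (2 * r))))"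
    using r unfolding char_std_normal_distribution by (simp add: power_divide)
  also have "(1 / sqrt r) *\<^sub>R complex_of_real (exp (- (\<xi>\<^sup>2 / (2 * r))))
      = exp (- (of_real \<xi>)\<^sup>2 / (2 * of_real r)) / csqrt (of_real r)"
    using r by (simp add: scaleR_conv_of_real exp_of_real[symmetric] csqrt_of_real_nonneg)
  finally show "(LINT x|lborel. iexp (\<xi> * x) / of_real (sqrt (2 * pi)) * of_real (exp (- r * (x\<^sup>2 / 2))))
      = exp (- (of_real \<xi>)\<^sup>2 / (2 * of_real r)) / csqrt (of_real r)" .
next
  show "(\<lambda>\<zeta>. exp (- (of_real \<xi>)\<^sup>2 / (2 * \<zeta>)) / csqrt \<zeta>) holomorphic_on {z. 0 < Re z}"
    by (intro holomorphic_intros) (auto simp: complex_nonpos_Reals_iff)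
qed (use assms in auto)

text \<open>The quadratic phase is absorbed into the Gaussian weight, turning its parameter 1 into
  the complex number \<open>Complex 1 (- 2 * w)\<close>.\<close>

lemma integral_std_normal_quadratic_phase:
  fixes w \<xi> :: real
  shows "(LINT x|std_normal_distribution. cis (w * x\<^sup>2 + \<xi> * x))
    = exp (- (of_real \<xi>)\<^sup>2 / (2 * Complex 1 (- 2 * w))) / csqrt (Complex 1 (- 2 * w))"
proof -
  have "(LINT x|std_normal_distribution. cis (w * x\<^sup>2 + \<xi> * x))
    = (LINT x|lborel. iexp (\<xi> * x) / of_real (sqrt (2 * pi)) * exp (- Complex 1 (- 2 * w) * of_real (x\<^sup>2 / 2)))"
  proof (subst integral_density)
    have "std_normal_density x *\<^sub>R cis (w * x\<^sup>2 + \<xi> * x)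
      = iexp (\<xi> * x) / of_real (sqrt (2 * pi)) * exp (- Complex 1 (- 2 * w) * of_real (x\<^sup>2 / 2))" for x
    proof -
      have "exp (- Complex 1 (- 2 * w) * of_real (x\<^sup>2 / 2)) = of_real (exp (- x\<^sup>2 / 2)) * exp (\<i> * of_real (w * x\<^sup>2))"
        unfolding exp_of_real[symmetric] exp_add[symmetric]
        by (rule arg_cong[of _ _ exp]) (simp add: complex_eq_iff)
      then show ?thesis
        by (simp add: std_normal_density_def scaleR_conv_of_real cis_conv_exp distrib_left exp_add mult_ac)
    qed
    then show "(LINT x|lborel. std_normal_density x *\<^sub>R cis (w * x\<^sup>2 + \<xi> * x)) = 
      (LINT x|lborel. iexp (\<xi> * x) / of_real (sqrt (2 * pi)) * exp (- Complex 1 (- 2 * w) * of_real (x\<^sup>2 / 2)))"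
      by simp
  qed (auto simp: cis_conv_exp)
  also have "\<dots> = exp (- (of_real \<xi>)\<^sup>2 / (2 * Complex 1 (- 2 * w))) / csqrt (Complex 1 (- 2 * w))"
    by (rule lborel_integral_gaussian_complex) simp
  finally show ?thesis .
qed

section \<open>Gamma laws\<close>

text \<open>The Gamma law of rate 1 and shape \<open>k + 1\<close>; the Erlang index is one below
  the shape.\<close>

abbreviation gamma_distribution :: "nat \<Rightarrow> real measure" where
  "gamma_distribution k \<equiv> density lborel (\<lambda>x. ennreal (erlang_density k 1 x))"

lemma integrable_erlang_density: "0 < l \<Longrightarrow> integrable lborel (erlang_density k l)"
  using nn_integral_erlang_ith_moment[of l k 0]
  by (intro integrableI_nonneg) (auto simp: )

lemma integral_erlang_density: "0 < l \<Longrightarrow> integral\<^sup>L lborel (erlang_density k l) = 1"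
  using nn_integral_erlang_ith_moment[of l k 0]
  by (subst integral_eq_nn_integral) (auto simp: )

text \<open>The phase changes the rate 1 into \<open>Complex 1 (- \<theta>)\<close>. For a real rate
  \<open>r\<close> the value \<open>1 / r ^ Suc k\<close> is the normalisation of the Erlang
  density.\<close>

lemma char_gamma_distribution:
  "(LINT x|gamma_distribution k. cis (\<theta> * x)) = 1 / (Complex 1 (- \<theta>)) ^ Suc k"
proof -
  have "(LINT x|gamma_distribution k. cis (\<theta> * x))
     = (LINT x|lborel. (if x < 0 then 0 else of_real (x ^ k / fact k)) * exp (- Complex 1 (- \<theta>) * of_real (max 0 x)))"
  proof (subst integral_density)
    have "erlang_density k 1 x *\<^sub>R cis (\<theta> * x)
      = (if x < 0 then 0 else of_real (x ^ k / fact k)) * exp (- Complex 1 (- \<theta>) * of_real (max 0 x))" for x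
    proof -
      have "exp (- Complex 1 (- \<theta>) * of_real x) = of_real (exp (- x)) * exp (\<i> * of_real (\<theta> * x))"
        unfolding exp_of_real[symmetric] exp_add[symmetric]
        by (rule arg_cong[of _ _ exp]) (simp add: complex_eq_iff)
      then show ?thesis
        by (auto simp: erlang_density_def scaleR_conv_of_real cis_conv_exp mult_ac)
    qed
    then show "(LINT x|lborel. erlang_density k 1 x *\<^sub>R cis (\<theta> * x)) = 
      (LINT x|lborel. (if x < 0 then 0 else of_real (x ^ k / fact k)) * exp (- Complex 1 (- \<theta>) * of_real (max 0 x)))"
      by simp
  qed (auto simp: cis_conv_exp)
  also have "\<dots> = 1 / (Complex 1 (- \<theta>)) ^ Suc k"
  proof (rule laplace_transform_eqI[where g = "\<lambda>z. 1 / z ^ Suc k"])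
    have eq: "(\<lambda>x. (if x < 0 then 0 else of_real (x ^ k / fact k)) * of_real (exp (- r * max 0 x)))
      = (\<lambda>x. complex_of_real ((1 / r ^ Suc k) * erlang_density k r x))" if "0 < r" for r :: real
      using that by (auto simp: erlang_density_def fun_eq_iff)
    fix r :: real assume r: "0 < r"
    show "integrable lborel (\<lambda>x. (if x < 0 then 0 else complex_of_real (x ^ k / fact k)) * of_real (exp (- r * max 0 x)))"
      unfolding eq[OF r] using integrable_erlang_density[OF r] by (intro integrable_of_real integrable_mult_right)
    show "(LINT x|lborel. (if x < 0 then 0 else of_real (x ^ k / fact k)) * of_real (exp (- r * max 0 x))) = 1 / complex_of_real r ^ Suc k"
      unfolding eq[OF r] using r by (subst integral_complex_of_real) (simp add: integral_erlang_density)
  qed (auto intro!: holomorphic_intros)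
  finally show ?thesis .
qed

lemma prob_space_gamma_distribution: "prob_space (gamma_distribution k)"
  by (rule prob_space_erlang_density) simp

lemma AE_gamma_distribution_pos: "AE x in gamma_distribution k. 0 < x"
proof (subst AE_density)
  show "AE x in lborel. 0 < ennreal (erlang_density k 1 x) \<longrightarrow> 0 < x"
    using AE_lborel_singleton[of "0::real"]
    by (rule eventually_mono) (auto simp: erlang_density_def split: if_splits)
qed simp

text \<open>Dividing the Erlang density of index \<open>k\<close> by \<open>x ^ j\<close> gives a
  multiple of the one of index \<open>k - j\<close>. A large index thus makes room for singularities
  at 0.\<close>

lemma integrable_gamma_distribution_inverse_power:
  assumes "j \<le> k"
  shows "integrable (gamma_distribution k) (\<lambda>x. inverse (x ^ j))"
proof (subst integrable_density)
  show "integrable lborel (\<lambda>x. erlang_density k 1 x *\<^sub>R inverse (x ^ j))"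
  proof (rule Bochner_Integration.integrable_bound)
    show "integrable lborel (\<lambda>x. fact (k - j) / fact k * erlang_density (k - j) 1 x)"
      by (intro integrable_mult_right integrable_erlang_density) simp
    show "AE x in lborel. norm (erlang_density k 1 x *\<^sub>R inverse (x ^ j)) \<le> norm (fact (k - j) / fact k * erlang_density (k - j) 1 x)"
      using AE_lborel_singleton[of 0]
    proof eventually_elim
      case (elim x)
      have "x ^ k = x ^ (k - j) * x ^ j" using assms by (simp add: power_add[symmetric])
      with elim show ?case by (simp add: erlang_density_def field_simps)
    qed
  qed simp
qed auto

section \<open>The standard Gaussian on a Euclidean space\<close>

text \<open>Defined as an image of a product measure, so that functions that factor over coordinates
  integrate to products of one-dimensional integrals.\<close>

definition gauss :: "'a::euclidean_space measure" where
  "gauss = distr (Pi\<^sub>M Basis (\<lambda>_. std_normal_distribution)) borel (\<lambda>f. \<Sum>b\<in>Basis. f b *\<^sub>R b)"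

lemma prob_space_std_normal_distribution: "prob_space std_normal_distribution"
  by (rule prob_space_normal_density) simp

lemma
  shows sets_gauss [simp, measurable_cong]: "sets gauss = sets borel"
    and space_gauss [simp]: "space gauss = UNIV"
  by (auto simp: gauss_def)

lemma measurable_gauss_map [measurable]:
  "(\<lambda>f. \<Sum>b\<in>Basis. f b *\<^sub>R b) \<in> borel_measurable (Pi\<^sub>M Basis (\<lambda>_. std_normal_distribution))"
proof (intro borel_measurable_sum borel_measurable_scaleR borel_measurable_const)
  fix b :: 'a assume "b \<in> Basis"
  then have "(\<lambda>f. f b) \<in> measurable (Pi\<^sub>M Basis (\<lambda>_. std_normal_distribution)) std_normal_distribution"
    by (rule measurable_component_singleton)
  then show "(\<lambda>f. f b) \<in> borel_measurable (Pi\<^sub>M Basis (\<lambda>_. std_normal_distribution))"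
    by simp
qed

lemma prob_space_gauss: "prob_space gauss"
  unfolding gauss_def
  by (intro prob_space.prob_space_distr prob_space_PiM prob_space_std_normal_distribution) measurable

lemma product_sigma_finite_std_normal: "product_sigma_finite (\<lambda>_. std_normal_distribution)"
  by (intro product_sigma_finite.intro prob_space_imp_sigma_finite prob_space_std_normal_distribution)

lemma integral_gauss_prod:
  fixes f :: "'a::euclidean_space \<Rightarrow> real \<Rightarrow> complex"
  assumes int: "\<And>b. b \<in> Basis \<Longrightarrow> integrable std_normal_distribution (f b)"
  shows "(LINT x|gauss. (\<Prod>b\<in>Basis. f b (x \<bullet> b))) = (\<Prod>b\<in>Basis. LINT x|std_normal_distribution. f b x)"
proof -
  have [measurable]: "f b \<in> borel_measurable borel" if "b \<in> Basis" for b
    using borel_measurable_integrable[OF int[OF that]] by simp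
  have "(LINT x|gauss. (\<Prod>b\<in>Basis. f b (x \<bullet> b)))
    = (LINT x|Pi\<^sub>M Basis (\<lambda>_. std_normal_distribution). (\<Prod>b\<in>Basis. f b (x b)))"
    unfolding gauss_def by (subst integral_distr) (auto intro!: Bochner_Integration.integral_cong prod.cong)
  also have "\<dots> = (\<Prod>b\<in>Basis. LINT x|std_normal_distribution. f b x)"
    by (rule product_sigma_finite.product_integral_prod[OF product_sigma_finite_std_normal]) (auto simp: int)
  finally show ?thesis .
qed

lemma nn_integral_gauss_prod:
  fixes f :: "'a::euclidean_space \<Rightarrow> real \<Rightarrow> ennreal"
  assumes [measurable]: "\<And>b. b \<in> Basis \<Longrightarrow> f b \<in> borel_measurable borel"
  shows "(\<integral>\<^sup>+x. (\<Prod>b\<in>Basis. f b (x \<bullet> b)) \<partial>gauss) = (\<Prod>b\<in>Basis. \<integral>\<^sup>+x. f b x \<partial>std_normal_distribution)"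
proof -
  have "(\<integral>\<^sup>+x. (\<Prod>b\<in>Basis. f b (x \<bullet> b)) \<partial>gauss)
    = (\<integral>\<^sup>+x. (\<Prod>b\<in>Basis. f b (x b)) \<partial>Pi\<^sub>M Basis (\<lambda>_. std_normal_distribution))"
    unfolding gauss_def by (subst nn_integral_distr) (auto intro!: nn_integral_cong prod.cong)
  also have "\<dots> = (\<Prod>b\<in>Basis. \<integral>\<^sup>+x. f b x \<partial>std_normal_distribution)"
    by (rule product_sigma_finite.product_nn_integral_prod[OF product_sigma_finite_std_normal]) auto
  finally show ?thesis .
qed

section \<open>Gaussian test functions and the cone\<close>

lemma cis_sum: "cis (\<Sum>b\<in>A. f b) = (\<Prod>b\<in>A. cis (f b))"
  by (induction A rule: infinite_finite_induct) (auto simp: cis_mult[symmetric])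

lemma norm_power2_Basis: "(norm x)\<^sup>2 = (\<Sum>b\<in>Basis. (x \<bullet> b)\<^sup>2)" for x :: "'a::euclidean_space"
  unfolding power2_norm_eq_inner by (subst euclidean_inner) (simp add: power2_eq_square)

lemma integrable_cis_prob:
  assumes "prob_space M" "f \<in> borel_measurable M"
  shows "integrable M (\<lambda>x. cis (f x))"
proof -
  interpret prob_space M by fact
  note assms(2)[measurable]
  show ?thesis by (rule integrable_const_bound[of _ 1]) (auto simp: cis_conv_exp)
qed

text \<open>The phase is a sum over coordinates, so the integral is a product of
  \<open>DIM('a)\<close> one-dimensional ones with a common parameter.\<close>

lemma integral_gauss_quadratic_phase:
  fixes w :: real and y :: "'a::euclidean_space"
  shows "(LINT x|gauss. cis (w * (norm x)\<^sup>2 + y \<bullet> x))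
    = exp (- of_real ((norm y)\<^sup>2) / (2 * Complex 1 (- 2 * w))) / csqrt (Complex 1 (- 2 * w)) ^ DIM('a)"
proof -
  let ?\<zeta> = "Complex 1 (- 2 * w)"
  have "cis (w * (norm x)\<^sup>2 + y \<bullet> x) = (\<Prod>b\<in>Basis. cis (w * (x \<bullet> b)\<^sup>2 + (y \<bullet> b) * (x \<bullet> b)))" for x :: 'a
    unfolding norm_power2_Basis euclidean_inner[of y x] cis_sum[symmetric]
    by (simp add: sum.distrib sum_distrib_left)
  then have "(LINT x|gauss. cis (w * (norm x)\<^sup>2 + y \<bullet> x))
    = (LINT x|gauss. (\<Prod>b\<in>Basis. cis (w * (x \<bullet> b)\<^sup>2 + (y \<bullet> b) * (x \<bullet> b))))"
    by simp
  also have "\<dots> = (\<Prod>b\<in>Basis. LINT x|std_normal_distribution. cis (w * x\<^sup>2 + (y \<bullet> b) * x))"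
    by (intro integral_gauss_prod[of "\<lambda>b x. cis (w * x\<^sup>2 + (y \<bullet> b) * x)"] integrable_cis_prob prob_space_std_normal_distribution) auto
  also have "\<dots> = (\<Prod>b\<in>(Basis :: 'a set). exp (- (of_real (y \<bullet> b))\<^sup>2 / (2 * ?\<zeta>)) / csqrt ?\<zeta>)"
    unfolding integral_std_normal_quadratic_phase ..
  also have "\<dots> = exp (\<Sum>b\<in>(Basis :: 'a set). - (of_real (y \<bullet> b))\<^sup>2 / (2 * ?\<zeta>)) / csqrt ?\<zeta> ^ DIM('a)"
    unfolding prod_dividef exp_sum[OF finite_Basis] by simp
  also have "(\<Sum>b\<in>(Basis :: 'a set). - (of_real (y \<bullet> b))\<^sup>2 / (2 * ?\<zeta>)) = - of_real ((norm y)\<^sup>2) / (2 * ?\<zeta>)"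
    unfolding norm_power2_Basis by (simp add: sum_divide_distrib sum_negf)
  finally show ?thesis .
qed

lemma integral_pair_prob_mult:
  fixes f :: "'a \<Rightarrow> complex" and g :: "'b \<Rightarrow> complex"
  assumes M: "prob_space M" and N: "prob_space N"
    and [measurable]: "f \<in> borel_measurable M" "g \<in> borel_measurable N"
    and f: "\<And>x. norm (f x) \<le> 1" and g: "\<And>x. norm (g x) \<le> 1"
  shows "(LINT z|(M \<Otimes>\<^sub>M N). f (fst z) * g (snd z)) = integral\<^sup>L M f * integral\<^sup>L N g"
proof -
  interpret M: prob_space M by fact
  interpret N: prob_space N by fact
  interpret pair_prob_space M N ..
  have "integrable (M \<Otimes>\<^sub>M N) (\<lambda>z. f (fst z) * g (snd z))"
    by (rule integrable_const_bound[of _ 1]) (auto simp: norm_mult intro!: mult_le_one f g)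
  from integral_fst'[OF this] show ?thesis by simp
qed

section \<open>The pairing of a measure on the cone with the test function\<close>

text \<open>The Gaussian integral over frequencies in closed form, for scale \<open>R\<close>, Gamma
  variable \<open>\<sigma>\<close> and last coordinate \<open>t\<close> of a point of the cone. The
  \<open>d\<close> space coordinates and the time coordinate contribute square roots of conjugate
  parameters, since \<open>cone_form\<close> has opposite signs on them.\<close>

definition cone_kernel :: "nat \<Rightarrow> real \<Rightarrow> real \<Rightarrow> real \<Rightarrow> complex" where
  "cone_kernel d R \<sigma> t = of_real (exp (- (4 * pi\<^sup>2 * R\<^sup>2 * t\<^sup>2) / (1 + 4 * R\<^sup>2 * \<sigma>\<^sup>2)))
     / (csqrt (Complex 1 (- 2 * (R * \<sigma>))) ^ d * csqrt (Complex 1 (2 * (R * \<sigma>))))"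

definition cone_form :: "'a::euclidean_space \<times> real \<Rightarrow> real" where
  "cone_form p = (norm (fst p))\<^sup>2 - (snd p)\<^sup>2"

lemma borel_measurable_cone_form [measurable]: "cone_form \<in> borel_measurable (borel \<Otimes>\<^sub>M borel)"
  unfolding cone_form_def by measurable

text \<open>On the cone the two Gaussian exponents, with conjugate parameters, add up to a real number,
  so the transform is not oscillating in \<^term>\<open>t\<close>.\<close>

lemma integral_gauss_cone_phase:
  fixes p :: "'a::euclidean_space \<times> real"
  assumes p: "p \<in> light_cone"
  shows "(LINT \<eta>|(gauss \<Otimes>\<^sub>M std_normal_distribution). cis (R * \<sigma> * cone_form \<eta> - 2 * pi * R * (\<eta> \<bullet> p)))
    = cone_kernel DIM('a) R \<sigma> (snd p)"
proof -
  obtain x t where px: "p = (x, t)" and xt: "(norm x)\<^sup>2 = t\<^sup>2"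
    using p by (auto simp: light_cone_def)
  let ?w = "R * \<sigma>" and ?y = "(- 2 * pi * R) *\<^sub>R x" and ?u = "- 2 * pi * R * t"
  let ?z = "Complex 1 (- 2 * ?w)" and ?z' = "Complex 1 (2 * ?w)"
  have "(LINT \<eta>|(gauss \<Otimes>\<^sub>M std_normal_distribution). cis (R * \<sigma> * cone_form \<eta> - 2 * pi * R * (\<eta> \<bullet> p)))
    = (LINT \<eta>|(gauss \<Otimes>\<^sub>M std_normal_distribution).
        cis (?w * (norm (fst \<eta>))\<^sup>2 + ?y \<bullet> fst \<eta>) * cis ((- ?w) * (snd \<eta>)\<^sup>2 + ?u * snd \<eta>))"
    unfolding cis_mult
    by (intro Bochner_Integration.integral_cong refl arg_cong[of _ _ cis])
       (simp add: px inner_prod_def cone_form_def algebra_simps inner_commute)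
  also have "\<dots> = (LINT \<xi>|gauss. cis (?w * (norm \<xi>)\<^sup>2 + ?y \<bullet> \<xi>)) * (LINT \<tau>|std_normal_distribution. cis ((- ?w) * \<tau>\<^sup>2 + ?u * \<tau>))"
    by (rule integral_pair_prob_mult)
       (auto intro: prob_space_gauss prob_space_std_normal_distribution simp: cis_conv_exp)
  also have "\<dots> = exp (- of_real ((norm ?y)\<^sup>2) / (2 * ?z)) / csqrt ?z ^ DIM('a)
      * (exp (- (of_real ?u)\<^sup>2 / (2 * ?z')) / csqrt ?z')"
    unfolding integral_gauss_quadratic_phase integral_std_normal_quadratic_phase by simp
  also have "\<dots> = exp (- of_real ((norm ?y)\<^sup>2) / (2 * ?z) + - (of_real ?u)\<^sup>2 / (2 * ?z')) / (csqrt ?z ^ DIM('a) * csqrt ?z')"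
    unfolding exp_add by simp
  also have "- of_real ((norm ?y)\<^sup>2) / (2 * ?z) + - (of_real ?u)\<^sup>2 / (2 * ?z')
    = complex_of_real (- (4 * pi\<^sup>2 * R\<^sup>2 * t\<^sup>2) / (1 + 4 * R\<^sup>2 * \<sigma>\<^sup>2))"
  proof -
    have nz: "?z \<noteq> 0" "?z' \<noteq> 0" by (auto simp: complex_eq_iff)
    have zz: "?z * ?z' = complex_of_real (1 + 4 * R\<^sup>2 * \<sigma>\<^sup>2)"
      by (simp add: complex_eq_iff power2_eq_square)
    have sum2: "?z + ?z' = 2" by (simp add: complex_eq_iff)
    \<comment> \<open>Only here does the point have to lie on the cone: equal numerators leave the
      sum of the reciprocals of \<open>?z\<close> and \<open>?z'\<close>, which is
      \<open>2 / (?z * ?z')\<close>, a real number.\<close>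
    have ny: "(norm ?y)\<^sup>2 = ?u\<^sup>2" using xt by (simp add: power_mult_distrib)
    have "- of_real ((norm ?y)\<^sup>2) / (2 * ?z) + - (of_real ?u)\<^sup>2 / (2 * ?z')
        = - complex_of_real (?u\<^sup>2) * (?z + ?z') / (2 * (?z * ?z'))"
      unfolding ny using nz by (simp add: divide_simps) (simp add: algebra_simps)
    also have "\<dots> = complex_of_real (- ?u\<^sup>2 / (1 + 4 * R\<^sup>2 * \<sigma>\<^sup>2))"
    proof -
      have "- complex_of_real v * 2 / (2 * complex_of_real b) = complex_of_real (- v / b)" for v b by simp
      then show ?thesis unfolding sum2 zz .
    qed
    finally show ?thesis by (simp add: power_mult_distrib)
  qed
  finally show ?thesis unfolding cone_kernel_def px exp_of_real snd_conv .
qed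

lemma borel_measurable_cone_kernel [measurable]:
  assumes [measurable]: "f \<in> borel_measurable M" "g \<in> borel_measurable M"
  shows "(\<lambda>x. cone_kernel d R (f x) (g x)) \<in> borel_measurable M"
proof -
  \<comment> \<open>\<open>csqrt\<close> jumps across the negative axis, so its measurability is
    read off its explicit formula in real square roots.\<close>
  have [measurable]: "csqrt \<in> borel_measurable borel"
    unfolding csqrt.code Complex_eq sgn_real_def by measurable
  have [measurable]: "(\<lambda>x. Complex 1 (h x)) \<in> borel_measurable M" if [measurable]: "h \<in> borel_measurable M" for h
    unfolding Complex_eq by measurable
  show ?thesis unfolding cone_kernel_def by measurable
qed

text \<open>By \<open>char_gamma_distribution\<close> the weight is an average of phases
  \<open>cis (R * \<sigma> * cone_form \<eta>)\<close>. Both factors are then averages of unimodular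
  functions over probability spaces, so Fubini applies and the integral over \<open>\<eta>\<close>
  can be done first.\<close>

lemma fourier_transform_gauss_gamma_test:
  fixes \<mu> :: "('a::euclidean_space \<times> real) measure"
  assumes \<mu>: "\<mu> \<in> borel_prob_on light_cone"
  shows "(LINT \<eta>|(gauss \<Otimes>\<^sub>M std_normal_distribution). fourier_transform \<mu> (R *\<^sub>R \<eta>) * (1 / Complex 1 (- (R * cone_form \<eta>)) ^ Suc k))
    = (LINT z|(\<mu> \<Otimes>\<^sub>M gamma_distribution k). cone_kernel DIM('a) R (snd z) (snd (fst z)))"
proof -
  have P\<mu>: "prob_space \<mu>" and s\<mu>: "sets \<mu> = sets borel"
    and cone: "emeasure \<mu> light_cone = 1" "light_cone \<in> sets \<mu>"
    using \<mu> unfolding borel_prob_on_def mem_Collect_eq by blast+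
  have [measurable_cong]: "sets \<mu> = sets (borel \<Otimes>\<^sub>M borel)"
    unfolding borel_prod by (rule s\<mu>)
  let ?G = "(gauss :: 'a measure) \<Otimes>\<^sub>M std_normal_distribution" and ?E = "gamma_distribution k"
  interpret \<mu>: prob_space \<mu> by fact
  interpret g: prob_space "gauss :: 'a measure" by (rule prob_space_gauss)
  interpret N: prob_space std_normal_distribution by (rule prob_space_std_normal_distribution)
  interpret E: prob_space ?E by (rule prob_space_gamma_distribution)
  interpret G: pair_prob_space "gauss :: 'a measure" std_normal_distribution ..
  interpret ME: pair_prob_space \<mu> ?E ..
  interpret A: pair_prob_space ?G "\<mu> \<Otimes>\<^sub>M ?E" ..
  let ?F = "\<lambda>\<eta> z. cis (R * snd z * cone_form \<eta> - 2 * pi * R * (\<eta> \<bullet> fst z))"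
  have [measurable]: "(\<lambda>(\<eta> :: 'a \<times> real, z). ?F \<eta> z) \<in> borel_measurable (?G \<Otimes>\<^sub>M (\<mu> \<Otimes>\<^sub>M ?E))"
    unfolding cis_conv_exp inner_prod_def by measurable
  have AEc: "AE x in \<mu>. x \<in> light_cone"
    using cone by (intro \<mu>.AE_prob_1) (simp add: measure_def)
  have "(LINT \<eta>|?G. fourier_transform \<mu> (R *\<^sub>R \<eta>) * (1 / Complex 1 (- (R * cone_form \<eta>)) ^ Suc k))
     = (LINT \<eta>|?G. LINT z|(\<mu> \<Otimes>\<^sub>M ?E). ?F \<eta> z)"
  proof (rule Bochner_Integration.integral_cong[OF refl])
    fix \<eta> :: "'a \<times> real"
    have "fourier_transform \<mu> (R *\<^sub>R \<eta>) * (1 / Complex 1 (- (R * cone_form \<eta>)) ^ Suc k)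
        = (LINT x|\<mu>. cis (- 2 * pi * (R *\<^sub>R \<eta> \<bullet> x))) * (LINT \<sigma>|?E. cis ((R * cone_form \<eta>) * \<sigma>))"
      unfolding fourier_transform_def char_gamma_distribution ..
    also have "\<dots> = (LINT z|(\<mu> \<Otimes>\<^sub>M ?E). cis (- 2 * pi * (R *\<^sub>R \<eta> \<bullet> fst z)) * cis ((R * cone_form \<eta>) * snd z))"
      by (rule integral_pair_prob_mult[symmetric, OF P\<mu> E.prob_space_axioms])
         (auto simp: cis_conv_exp inner_prod_def)
    also have "\<dots> = (LINT z|(\<mu> \<Otimes>\<^sub>M ?E). ?F \<eta> z)"
      unfolding cis_mult
      by (intro Bochner_Integration.integral_cong refl arg_cong[of _ _ cis]) (simp add: algebra_simps)
    finally show "fourier_transform \<mu> (R *\<^sub>R \<eta>) * (1 / Complex 1 (- (R * cone_form \<eta>)) ^ Suc k) = \<dots>" .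
  qed
  also have "\<dots> = (LINT z|(\<mu> \<Otimes>\<^sub>M ?E). LINT \<eta>|?G. ?F \<eta> z)"
    by (rule A.Fubini_integral[symmetric], rule A.integrable_const_bound[of _ 1]) auto
  also have "\<dots> = (LINT z|(\<mu> \<Otimes>\<^sub>M ?E). cone_kernel DIM('a) R (snd z) (snd (fst z)))"
  proof (rule integral_cong_AE)
    have "AE z in \<mu> \<Otimes>\<^sub>M ?E. fst z \<in> light_cone"
    proof (rule ME.AE_pair_measure)
      show "{z \<in> space (\<mu> \<Otimes>\<^sub>M ?E). fst z \<in> light_cone} \<in> sets (\<mu> \<Otimes>\<^sub>M ?E)"
        using cone(2) by measurable
    qed (use AEc in auto)
    then show "AE z in \<mu> \<Otimes>\<^sub>M ?E. (LINT \<eta>|?G. ?F \<eta> z) = cone_kernel DIM('a) R (snd z) (snd (fst z))"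
      by eventually_elim (rule integral_gauss_cone_phase)
  qed measurable
  finally show ?thesis .
qed

section \<open>Scaling limit of the kernel\<close>

lemma Complex_eq_0: "Complex a b = 0 \<longleftrightarrow> a = 0 \<and> b = 0"
  by (simp add: complex_eq_iff)

lemma csqrt_of_real_mult: "0 < r \<Longrightarrow> csqrt (of_real r * z) = of_real (sqrt r) * csqrt z"
  using csqrt_principal[of z]
  by (intro csqrt_unique) (auto simp: power_mult_distrib simp flip: of_real_power)

text \<open>Each of the \<open>d + 1\<close> complex square roots releases a factor
  \<open>sqrt R\<close>. What remains depends on \<open>R\<close> only through \<open>1 / R\<close>,
  and so has a limit.\<close>

lemma cone_kernel_scaled:
  assumes R: "0 < R" and \<sigma>: "0 < \<sigma>"
  shows "of_real (sqrt R ^ Suc d) * cone_kernel d R \<sigma> t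
    = of_real (exp (- (4 * pi\<^sup>2 * t\<^sup>2) / ((1 / R)\<^sup>2 + 4 * \<sigma>\<^sup>2)))
      / (csqrt (Complex (1 / R) (- 2 * \<sigma>)) ^ d * csqrt (Complex (1 / R) (2 * \<sigma>)))"
proof -
  have eq: "Complex 1 (- 2 * (R * \<sigma>)) = of_real R * Complex (1 / R) (- 2 * \<sigma>)"
    "Complex 1 (2 * (R * \<sigma>)) = of_real R * Complex (1 / R) (2 * \<sigma>)"
    using R by (auto simp: complex_eq_iff)
  have "4 * pi\<^sup>2 * R\<^sup>2 * t\<^sup>2 / (1 + 4 * R\<^sup>2 * \<sigma>\<^sup>2) = (R\<^sup>2 * (4 * pi\<^sup>2 * t\<^sup>2)) / (R\<^sup>2 * ((1 / R)\<^sup>2 + 4 * \<sigma>\<^sup>2))"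
    using R by (simp add: distrib_left power_divide mult_ac)
  also have "\<dots> = 4 * pi\<^sup>2 * t\<^sup>2 / ((1 / R)\<^sup>2 + 4 * \<sigma>\<^sup>2)"
    using R by (subst mult_divide_mult_cancel_left) auto
  finally have e: "4 * pi\<^sup>2 * R\<^sup>2 * t\<^sup>2 / (1 + 4 * R\<^sup>2 * \<sigma>\<^sup>2) = 4 * pi\<^sup>2 * t\<^sup>2 / ((1 / R)\<^sup>2 + 4 * \<sigma>\<^sup>2)" .
  show ?thesis
    unfolding cone_kernel_def eq csqrt_of_real_mult[OF R] minus_divide_left[symmetric] e
    using R by (simp add: power_mult_distrib)
qed

text \<open>The imaginary parts alone bound the denominator from below, which gives a majorant
  independent of \<open>R\<close> and \<open>t\<close>.\<close>

lemma norm_cone_kernel_scaled_le: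
  assumes R: "0 < R" and \<sigma>: "0 < \<sigma>"
  shows "norm (of_real (sqrt R ^ Suc d) * cone_kernel d R \<sigma> t) \<le> 1 / sqrt \<sigma> ^ Suc d"
proof -
  have *: "sqrt \<sigma> \<le> norm (csqrt z)" if "\<sigma> \<le> \<bar>Im z\<bar>" for z
    using that abs_Im_le_cmod[of z] by (simp add: norm_csqrt)
  have "norm (csqrt (Complex (1 / R) (- 2 * \<sigma>)) ^ d * csqrt (Complex (1 / R) (2 * \<sigma>))) \<ge> sqrt \<sigma> ^ d * sqrt \<sigma>"
    unfolding norm_mult norm_power using \<sigma>
    by (intro mult_mono power_mono *) auto
  then show ?thesis
    unfolding cone_kernel_scaled[OF R \<sigma>] norm_divide norm_of_real
    using \<sigma> R by (intro frac_le) (auto simp: mult.commute)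
qed

lemma cone_kernel_scaled_tendsto:
  assumes \<sigma>: "0 < \<sigma>"
  shows "(\<lambda>n. of_real (sqrt (real (Suc n)) ^ Suc d) * cone_kernel d (real (Suc n)) \<sigma> t) \<longlonglongrightarrow>
    1 / (csqrt (Complex 0 (- 2)) ^ d * csqrt (Complex 0 2)) * of_real (exp (- (pi\<^sup>2 * t\<^sup>2) / \<sigma>\<^sup>2) / sqrt \<sigma> ^ Suc d)"
proof -
  have "(\<lambda>n. of_real (exp (- (4 * pi\<^sup>2 * t\<^sup>2) / ((1 / real (Suc n))\<^sup>2 + 4 * \<sigma>\<^sup>2)))
      / (csqrt (Complex (1 / real (Suc n)) (- 2 * \<sigma>)) ^ d * csqrt (Complex (1 / real (Suc n)) (2 * \<sigma>))))
    \<longlonglongrightarrow> of_real (exp (- (4 * pi\<^sup>2 * t\<^sup>2) / (0\<^sup>2 + 4 * \<sigma>\<^sup>2))) / (csqrt (Complex 0 (- 2 * \<sigma>)) ^ d * csqrt (Complex 0 (2 * \<sigma>)))"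
  proof -
    have l: "(\<lambda>n. 1 / real (Suc n)) \<longlonglongrightarrow> 0" using LIMSEQ_inverse_real_of_nat by (simp add: inverse_eq_divide)
    \<comment> \<open>A nonzero imaginary part keeps the limit point off the branch cut, where
      \<open>csqrt\<close> is continuous.\<close>
    have c: "(\<lambda>n. csqrt (Complex (1 / real (Suc n)) b)) \<longlonglongrightarrow> csqrt (Complex 0 b)" if "b \<noteq> 0" for b
      using that by (intro isCont_tendsto_compose[OF _ tendsto_Complex[OF l tendsto_const]] continuous_at_csqrt)
        (auto simp: complex_nonpos_Reals_iff)
    show ?thesis
      using \<sigma> by (intro tendsto_intros l c) (auto simp: Complex_eq_0)
  qed
  moreover have "csqrt (Complex 0 (- 2 * \<sigma>)) = of_real (sqrt \<sigma>) * csqrt (Complex 0 (- 2))"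
    "csqrt (Complex 0 (2 * \<sigma>)) = of_real (sqrt \<sigma>) * csqrt (Complex 0 2)"
  proof -
    have "Complex 0 (- 2 * \<sigma>) = of_real \<sigma> * Complex 0 (- 2)" "Complex 0 (2 * \<sigma>) = of_real \<sigma> * Complex 0 2"
      by (auto simp: complex_eq_iff)
    then show "csqrt (Complex 0 (- 2 * \<sigma>)) = of_real (sqrt \<sigma>) * csqrt (Complex 0 (- 2))"
      "csqrt (Complex 0 (2 * \<sigma>)) = of_real (sqrt \<sigma>) * csqrt (Complex 0 2)"
      by (simp_all only: csqrt_of_real_mult[OF \<sigma>])
  qed
  moreover have "4 * pi\<^sup>2 * t\<^sup>2 / (0\<^sup>2 + 4 * \<sigma>\<^sup>2) = pi\<^sup>2 * t\<^sup>2 / \<sigma>\<^sup>2" by simp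
  ultimately show ?thesis
    unfolding cone_kernel_scaled[OF of_nat_0_less_iff[THEN iffD2, OF zero_less_Suc] \<sigma>] minus_divide_left[symmetric]
    by (simp add: power_mult_distrib mult_ac)
qed

text \<open>Replaces half-integer powers by integer ones, the form covered by
  \<open>integrable_gamma_distribution_inverse_power\<close>.\<close>

lemma inverse_sqrt_power_le:
  fixes x :: real
  assumes x: "0 < x"
  shows "1 / sqrt x ^ q \<le> 1 + inverse (x ^ q)"
proof (cases "1 \<le> x")
  case True
  then have "1 \<le> sqrt x ^ q" by (intro one_le_power) simp
  then have "1 / sqrt x ^ q \<le> 1" by (simp add: divide_simps)
  then show ?thesis using x by (smt (verit) positive_imp_inverse_positive zero_less_power)
next
  case False
  then have "x \<le> sqrt x" using x real_le_rsqrt[of x x] by (simp add: power2_eq_square mult_le_one mult_left_le)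
  then have "x ^ q \<le> sqrt x ^ q" using x by (intro power_mono) auto
  then have "1 / sqrt x ^ q \<le> 1 / x ^ q" using x by (intro divide_left_mono) auto
  then show ?thesis by (simp add: inverse_eq_divide)
qed

text \<open>Dominated convergence, with \<open>Suc d \<le> k\<close> making the majorant integrable.
  The limit is a nonzero complex constant \<open>c\<close> times the integral of a strictly positive
  function against a probability measure, hence it cannot vanish.\<close>

lemma cone_kernel_integral_limit:
  fixes \<mu> :: "('a::euclidean_space \<times> real) measure"
  assumes \<mu>: "\<mu> \<in> borel_prob_on light_cone" and dk: "Suc d \<le> k"
  obtains L where "L \<noteq> 0"
    "(\<lambda>n. of_real (sqrt (real (Suc n)) ^ Suc d) *
        (LINT z|(\<mu> \<Otimes>\<^sub>M gamma_distribution k). cone_kernel d (real (Suc n)) (snd z) (snd (fst z)))) \<longlonglongrightarrow> L"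
proof -
  let ?E = "gamma_distribution k"
  have P\<mu>: "prob_space \<mu>" and s\<mu>: "sets \<mu> = sets borel"
    using \<mu> unfolding borel_prob_on_def mem_Collect_eq by blast+
  have [measurable_cong]: "sets \<mu> = sets (borel \<Otimes>\<^sub>M borel)"
    unfolding borel_prod by (rule s\<mu>)
  interpret \<mu>: prob_space \<mu> by fact
  interpret E: prob_space ?E by (rule prob_space_gamma_distribution)
  interpret ME: pair_prob_space \<mu> ?E ..
  define c where "c = 1 / (csqrt (Complex 0 (- 2)) ^ d * csqrt (Complex 0 2))"
  define g :: "('a \<times> real) \<times> real \<Rightarrow> real" where "g z = exp (- (pi\<^sup>2 * (snd (fst z))\<^sup>2) / (snd z)\<^sup>2) / sqrt (snd z) ^ Suc d" for z
  have c: "c \<noteq> 0" by (simp add: c_def Complex_eq_0)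
  have [measurable]: "g \<in> borel_measurable (\<mu> \<Otimes>\<^sub>M ?E)" unfolding g_def by measurable
  have AE_pos: "AE z in \<mu> \<Otimes>\<^sub>M ?E. 0 < snd z"
  proof (rule ME.AE_pair_measure)
    show "{z \<in> space (\<mu> \<Otimes>\<^sub>M ?E). 0 < snd z} \<in> sets (\<mu> \<Otimes>\<^sub>M ?E)" by measurable
  qed (use AE_gamma_distribution_pos in auto)
  have int: "integrable (\<mu> \<Otimes>\<^sub>M ?E) (\<lambda>z. 1 + inverse (snd z ^ Suc d))"
  proof -
    have "integrable (\<mu> \<Otimes>\<^sub>M ?E) (\<lambda>z. inverse (snd z ^ Suc d))"
      using integrable_gamma_distribution_inverse_power[OF dk]
      by (intro ME.Fubini_integrable) auto
    then show ?thesis by simp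
  qed
  have "(\<lambda>n. LINT z|(\<mu> \<Otimes>\<^sub>M ?E). of_real (sqrt (real (Suc n)) ^ Suc d) * cone_kernel d (real (Suc n)) (snd z) (snd (fst z)))
    \<longlonglongrightarrow> (LINT z|(\<mu> \<Otimes>\<^sub>M ?E). c * of_real (g z))"
  proof (rule integral_dominated_convergence[OF _ _ int])
    show "AE z in \<mu> \<Otimes>\<^sub>M ?E. (\<lambda>n. of_real (sqrt (real (Suc n)) ^ Suc d) * cone_kernel d (real (Suc n)) (snd z) (snd (fst z)))
        \<longlonglongrightarrow> c * of_real (g z)"
      using AE_pos by eventually_elim (unfold c_def g_def, rule cone_kernel_scaled_tendsto)
    show "AE z in \<mu> \<Otimes>\<^sub>M ?E. norm (of_real (sqrt (real (Suc n)) ^ Suc d) * cone_kernel d (real (Suc n)) (snd z) (snd (fst z)))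
        \<le> 1 + inverse (snd z ^ Suc d)" for n
      using AE_pos
    proof eventually_elim
      case (elim z)
      show ?case by (rule order_trans[OF norm_cone_kernel_scaled_le inverse_sqrt_power_le]) (use elim in auto)
    qed
  qed measurable
  moreover have "(LINT z|(\<mu> \<Otimes>\<^sub>M ?E). c * of_real (g z)) \<noteq> 0"
  proof -
    have intg: "integrable (\<mu> \<Otimes>\<^sub>M ?E) g"
    proof (rule Bochner_Integration.integrable_bound[OF int])
      show "AE z in \<mu> \<Otimes>\<^sub>M ?E. norm (g z) \<le> norm (1 + inverse (snd z ^ Suc d))"
        using AE_pos
      proof eventually_elim
        case (elim z)
        have "norm (g z) \<le> 1 / sqrt (snd z) ^ Suc d"
          using elim by (simp add: g_def divide_right_mono)
        also note inverse_sqrt_power_le[OF elim, of "Suc d"]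
        finally show ?case using elim by simp
      qed
    qed simp
    have gpos: "AE z in \<mu> \<Otimes>\<^sub>M ?E. 0 < g z"
      using AE_pos by eventually_elim (simp add: g_def)
    have g0: "AE z in \<mu> \<Otimes>\<^sub>M ?E. 0 \<le> g z"
      using gpos by eventually_elim simp
    have "(LINT z|(\<mu> \<Otimes>\<^sub>M ?E). g z) \<noteq> 0"
    proof
      assume "(LINT z|(\<mu> \<Otimes>\<^sub>M ?E). g z) = 0"
      then have "AE z in \<mu> \<Otimes>\<^sub>M ?E. g z = 0"
        using integral_nonneg_eq_0_iff_AE[OF intg g0] by simp
      then have "AE z in \<mu> \<Otimes>\<^sub>M ?E. False" by (rule eventually_elim2[OF gpos]) simp
      then show False by simp
    qed
    with c show ?thesis by simp
  qed
  ultimately show ?thesis unfolding integral_mult_right_zero by (rule that[rotated])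
qed

section \<open>Integrability of a weight singular along the dual cone\<close>

text \<open>Within distance 1 of \<open>a\<close> the density is at most 1 and the power is
  integrable; farther away the power is at most 1. The bound is uniform in \<open>a\<close>, which
  will later be \<open>norm \<xi>\<close> or its negative.\<close>

lemma nn_integral_std_normal_powr_le:
  assumes \<gamma>: "0 \<le> \<gamma>" "\<gamma> < 1"
  shows "(\<integral>\<^sup>+x. ennreal (\<bar>x - a\<bar> powr (- \<gamma>)) \<partial>std_normal_distribution) \<le> ennreal (1 + 2 / (1 - \<gamma>))"
proof -
  \<comment> \<open>One side of the singularity, of mass \<open>1 / (1 - \<gamma>)\<close>; two
    reflected copies of it cover the interval around \<open>a\<close>.\<close>
  define F where "F y = ennreal (y powr (- \<gamma>)) * indicator {0..1} y" for y :: real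
  have [measurable]: "F \<in> borel_measurable borel" unfolding F_def by measurable
  have F: "(\<integral>\<^sup>+y. F y \<partial>lborel) = ennreal (1 / (1 - \<gamma>))"
    unfolding F_def using has_integral_powr_from_0[of "- \<gamma>" 1] \<gamma>
    by (subst nn_integral_has_integral_lebesgue') auto
  have le: "std_normal_density x \<le> 1" for x
  proof -
    have "1 \<le> sqrt (2 * pi)" using pi_gt3 by simp
    then have "1 / sqrt (2 * pi) * exp (- x\<^sup>2 / 2) \<le> 1 * 1" by (intro mult_mono) auto
    then show ?thesis by (simp add: std_normal_density_def)
  qed
  have "(\<integral>\<^sup>+x. ennreal (\<bar>x - a\<bar> powr (- \<gamma>)) \<partial>std_normal_distribution)
      = (\<integral>\<^sup>+x. ennreal (std_normal_density x) * ennreal (\<bar>x - a\<bar> powr (- \<gamma>)) \<partial>lborel)"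
    by (subst nn_integral_density) auto
  also have "\<dots> \<le> (\<integral>\<^sup>+x. ennreal (std_normal_density x) + (F (- a + 1 * x) + F (a + (- 1) * x)) \<partial>lborel)"
  proof (rule nn_integral_mono)
    fix x :: real
    show "ennreal (std_normal_density x) * ennreal (\<bar>x - a\<bar> powr (- \<gamma>)) \<le> ennreal (std_normal_density x) + (F (- a + 1 * x) + F (a + (- 1) * x))"
    proof (cases "\<bar>x - a\<bar> \<le> 1")
      case True
      have "ennreal (std_normal_density x) * ennreal (\<bar>x - a\<bar> powr (- \<gamma>)) \<le> 1 * ennreal (\<bar>x - a\<bar> powr (- \<gamma>))"
        using le[of x] by (intro mult_right_mono) auto
      also have "\<dots> \<le> F (- a + 1 * x) + F (a + (- 1) * x)"
        using True by (cases "a \<le> x") (auto simp: F_def indicator_def add.commute[of _ x])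
      finally show ?thesis by (simp add: add_increasing)
    next
      case False
      then have "\<bar>x - a\<bar> powr (- \<gamma>) \<le> 1" using powr_mono[of "- \<gamma>" 0 "\<bar>x - a\<bar>"] \<gamma> by (cases "x = a") auto
      then have "ennreal (std_normal_density x) * ennreal (\<bar>x - a\<bar> powr (- \<gamma>)) \<le> ennreal (std_normal_density x) * 1"
        by (intro mult_left_mono) auto
      then show ?thesis by (simp add: add_increasing2)
    qed
  qed
  also have "\<dots> = (\<integral>\<^sup>+x. ennreal (std_normal_density x) \<partial>lborel) + ((\<integral>\<^sup>+x. F (- a + 1 * x) \<partial>lborel) + (\<integral>\<^sup>+x. F (a + (- 1) * x) \<partial>lborel))"
    by (subst nn_integral_add; (subst nn_integral_add)?) auto
  also have "(\<integral>\<^sup>+x. ennreal (std_normal_density x) \<partial>lborel) = 1"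
    using prob_space.emeasure_space_1[OF prob_space_std_normal_distribution] by (simp add: emeasure_density)
  also have "(\<integral>\<^sup>+x. F (- a + 1 * x) \<partial>lborel) = ennreal (1 / (1 - \<gamma>))"
    unfolding F[symmetric] by (subst nn_integral_real_affine[of F 1 "- a"]) auto
  also have "(\<integral>\<^sup>+x. F (a + (- 1) * x) \<partial>lborel) = ennreal (1 / (1 - \<gamma>))"
    unfolding F[symmetric] by (subst nn_integral_real_affine[of F "- 1" a]) auto
  also have "1 + (ennreal (1 / (1 - \<gamma>)) + ennreal (1 / (1 - \<gamma>))) = ennreal (1 + 2 / (1 - \<gamma>))"
    using \<gamma> by (simp flip: ennreal_plus ennreal_1)
  finally show ?thesis .
qed

lemma AE_std_normal_neq: "AE x in std_normal_distribution. x \<noteq> c"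
  by (subst AE_density) (auto intro: eventually_mono[OF AE_lborel_singleton[of c]])

lemma AE_gauss_coordinate_neq_0:
  assumes b: "b \<in> Basis"
  shows "AE x in gauss. x \<bullet> b \<noteq> (0 :: real)"
proof -
  have N0: "emeasure std_normal_distribution {0} = 0"
    using AE_std_normal_neq[of 0] by (subst (asm) AE_iff_measurable[of "{0}"]) auto
  have "emeasure gauss {x. x \<bullet> b = 0} = (\<integral>\<^sup>+x. (\<Prod>b'\<in>Basis. (if b' = b then indicator {0} else (\<lambda>_. 1)) (x \<bullet> b')) \<partial>gauss)"
  proof -
    have "(\<Prod>b'\<in>Basis. (if b' = b then indicator {0} else (\<lambda>_. 1)) (x \<bullet> b')) = (indicator {x. x \<bullet> b = 0} x :: ennreal)" for x
    proof -
      have "(\<Prod>b'\<in>Basis. (if b' = b then indicator {0} else (\<lambda>_. 1)) (x \<bullet> b'))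
          = (\<Prod>b'\<in>Basis. if b' = b then indicator {0} (x \<bullet> b) else (1 :: ennreal))"
        by (intro prod.cong) auto
      also have "\<dots> = indicator {0} (x \<bullet> b)" using b by (simp add: prod.delta)
      finally show ?thesis by (simp add: indicator_def)
    qed
    then show ?thesis by simp
  qed
  also have "\<dots> = (\<Prod>b'\<in>Basis. \<integral>\<^sup>+x. (if b' = b then indicator {0} else (\<lambda>_. 1)) x \<partial>std_normal_distribution)"
    by (rule nn_integral_gauss_prod) auto
  also have "\<dots> = 0"
    using b N0 by (intro prod_zero) auto
  finally show ?thesis by (intro AE_I[of _ _ "{x. x \<bullet> b = 0}"]) auto
qed

text \<open>Every coordinate is bounded by the norm, so the exponent can be shared equally among the
  coordinates; each share is below 1 and integrable in one variable.\<close>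

lemma nn_integral_gauss_norm_powr_finite:
  fixes \<alpha> :: real
  assumes \<alpha>: "0 \<le> \<alpha>" "\<alpha> < DIM('a)"
  shows "(\<integral>\<^sup>+x. ennreal (norm x powr (- \<alpha>)) \<partial>(gauss :: 'a::euclidean_space measure)) < \<infinity>"
proof -
  let ?\<gamma> = "\<alpha> / DIM('a)"
  have \<gamma>: "0 \<le> ?\<gamma>" "?\<gamma> < 1" using \<alpha> by auto
  have "AE x in gauss. \<forall>b\<in>Basis. x \<bullet> b \<noteq> 0" for x :: 'a
    by (intro AE_finite_allI) (auto intro: AE_gauss_coordinate_neq_0)
  then have "AE x in (gauss :: 'a measure). ennreal (norm x powr (- \<alpha>)) \<le> (\<Prod>b\<in>Basis. ennreal (\<bar>x \<bullet> b - 0\<bar> powr (- ?\<gamma>)))"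
  proof eventually_elim
    case (elim x)
    then have x: "x \<noteq> 0" using nonempty_Basis by auto
    have "norm x powr (- \<alpha>) = (norm x powr (- ?\<gamma>)) ^ DIM('a)"
      using x by (simp add: powr_realpow[symmetric] powr_powr)
    also have "\<dots> = (\<Prod>b\<in>(Basis::'a set). norm x powr (- ?\<gamma>))" by simp
    also have "\<dots> \<le> (\<Prod>b\<in>Basis. \<bar>x \<bullet> b - 0\<bar> powr (- ?\<gamma>))"
      using elim \<gamma> by (intro prod_mono conjI powr_mono2') (auto simp: Basis_le_norm)
    finally show ?case by (simp add: prod_ennreal ennreal_leI)
  qed
  then have "(\<integral>\<^sup>+x. ennreal (norm x powr (- \<alpha>)) \<partial>(gauss :: 'a measure))
      \<le> (\<integral>\<^sup>+x. (\<Prod>b\<in>Basis. ennreal (\<bar>x \<bullet> b - 0\<bar> powr (- ?\<gamma>))) \<partial>(gauss :: 'a measure))"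
    by (rule nn_integral_mono_AE)
  also have "\<dots> = (\<Prod>b\<in>(Basis :: 'a set). \<integral>\<^sup>+x. ennreal (\<bar>x - 0\<bar> powr (- ?\<gamma>)) \<partial>std_normal_distribution)"
    by (rule nn_integral_gauss_prod) auto
  also have "\<dots> < \<infinity>"
    using le_less_trans[OF nn_integral_std_normal_powr_le[OF \<gamma>, of 0] ennreal_less_top]
    by (simp add: power_less_top_ennreal)
  finally show ?thesis .
qed

text \<open>The quantity \<open>\<bar>cone_form \<eta>\<bar>\<close> is the product of a distance
  \<open>D\<close> to the cone and a size \<open>S\<close>. The powers of size,
  \<open>p + \<theta>\<close> in total, are split into \<open>\<alpha>\<close> charged to
  \<open>norm \<xi>\<close> and \<open>\<beta>\<close> charged to \<open>D\<close>. Then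
  \<open>\<beta> + \<theta> < 1\<close> settles the integral over \<open>\<tau>\<close> and
  \<open>\<alpha> < DIM('a)\<close> the one over \<open>\<xi>\<close>.\<close>

lemma nn_integral_cone_weight_finite:
  fixes p \<theta> \<alpha> \<beta> :: real
  assumes p: "0 \<le> p" "0 \<le> \<theta>" "0 \<le> \<alpha>" "0 \<le> \<beta>" and sum: "\<alpha> + \<beta> = p + \<theta>"
    and less: "\<beta> + \<theta> < 1" "\<alpha> < DIM('a)"
  shows "(\<integral>\<^sup>+\<eta>. ennreal (norm \<eta> powr (- p) * \<bar>cone_form \<eta>\<bar> powr (- \<theta>))
    \<partial>((gauss :: 'a::euclidean_space measure) \<Otimes>\<^sub>M std_normal_distribution)) < \<infinity>"
proof -
  let ?N = std_normal_distribution
  interpret N: prob_space ?N by (rule prob_space_std_normal_distribution)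
  let ?h = "\<lambda>\<eta> :: 'a \<times> real. ennreal (norm \<eta> powr (- p) * \<bar>cone_form \<eta>\<bar> powr (- \<theta>))"
  let ?\<gamma> = "\<beta> + \<theta>"
  define K where "K = 1 + 2 / (1 - ?\<gamma>)"
  have K0: "0 \<le> K" using less p by (simp add: K_def)
  have key: "norm (\<xi>, \<tau>) powr (- p) * \<bar>cone_form (\<xi>, \<tau>)\<bar> powr (- \<theta>)
      \<le> norm \<xi> powr (- \<alpha>) * (\<bar>\<tau> - norm \<xi>\<bar> powr (- ?\<gamma>) + \<bar>\<tau> - (- norm \<xi>)\<bar> powr (- ?\<gamma>))"
    if \<xi>: "\<xi> \<noteq> 0" for \<xi> :: 'a and \<tau> :: real
  proof -
    define D where "D = \<bar>norm \<xi> - \<bar>\<tau>\<bar>\<bar>"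
    define S where "S = norm \<xi> + \<bar>\<tau>\<bar>"
    \<comment> \<open>A common lower bound of \<open>norm (\<xi>, \<tau>)\<close> and
      \<open>S\<close> that dominates both \<open>norm \<xi>\<close> and \<open>D\<close>, so its
      negative power can be divided between these two.\<close>
    define m where "m = max (norm \<xi>) D"
    have "cone_form (\<xi>, \<tau>) = (norm \<xi> - \<bar>\<tau>\<bar>) * (norm \<xi> + \<bar>\<tau>\<bar>)"
      by (simp add: cone_form_def power2_eq_square algebra_simps)
    then have Q: "\<bar>cone_form (\<xi>, \<tau>)\<bar> = D * S"
      by (simp add: D_def S_def abs_mult)
    show ?thesis
    proof (cases "D = 0")
      case True
      \<comment> \<open>On the cone the left side is 0, since \<open>0 powr (- \<theta>)\<close> is
        0 by convention.\<close>
      then show ?thesis unfolding Q by simp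
    next
      case False
      then have D: "0 < D" by (simp add: D_def)
      have nx: "0 < norm \<xi>" using \<xi> by simp
      have \<tau>: "\<bar>\<tau>\<bar> \<le> norm (\<xi>, \<tau>)" and \<xi>': "norm \<xi> \<le> norm (\<xi>, \<tau>)"
        using norm_snd_le[of \<tau> \<xi>] norm_fst_le[of \<xi> \<tau>] by auto
      have m: "0 < m" "m \<le> norm (\<xi>, \<tau>)" "m \<le> S"
        using nx D \<tau> \<xi>' norm_ge_zero[of \<xi>] unfolding m_def D_def S_def by linarith+
      have "norm (\<xi>, \<tau>) powr (- p) * \<bar>cone_form (\<xi>, \<tau>)\<bar> powr (- \<theta>)
          = norm (\<xi>, \<tau>) powr (- p) * S powr (- \<theta>) * D powr (- \<theta>)"
        unfolding Q using D m by (simp add: powr_mult mult_ac)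
      also have "\<dots> \<le> m powr (- p) * m powr (- \<theta>) * D powr (- \<theta>)"
        using m p by (intro mult_right_mono mult_mono powr_mono2') auto
      also have "m powr (- p) * m powr (- \<theta>) = m powr (- \<alpha>) * m powr (- \<beta>)"
        unfolding powr_add[symmetric] using sum by (intro arg_cong[of _ _ "(powr) m"]) linarith
      also have "m powr (- \<alpha>) * m powr (- \<beta>) * D powr (- \<theta>)
          \<le> norm \<xi> powr (- \<alpha>) * D powr (- \<beta>) * D powr (- \<theta>)"
        using nx D p by (intro mult_right_mono mult_mono powr_mono2') (auto simp: m_def)
      also have "\<dots> = norm \<xi> powr (- \<alpha>) * D powr (- ?\<gamma>)"
        using D by (simp add: powr_add[symmetric] mult.assoc)
      \<comment> \<open>\<open>D\<close> is the distance from \<open>\<tau>\<close> to whichever of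
        \<open>norm \<xi>\<close> and its negative has the same sign; summing over both centres
        removes the sign.\<close>
      also have "D powr (- ?\<gamma>) \<le> \<bar>\<tau> - norm \<xi>\<bar> powr (- ?\<gamma>) + \<bar>\<tau> - (- norm \<xi>)\<bar> powr (- ?\<gamma>)"
      proof (cases "0 \<le> \<tau>")
        case True
        then have "D = \<bar>\<tau> - norm \<xi>\<bar>" by (simp add: D_def abs_minus_commute)
        then show ?thesis by simp
      next
        case False
        then have "D = \<bar>\<tau> - (- norm \<xi>)\<bar>" by (simp add: D_def add.commute)
        then show ?thesis by simp
      qed
      finally show ?thesis by (simp add: mult_left_mono)
    qed
  qed
  have [measurable]: "?h \<in> borel_measurable ((gauss :: 'a measure) \<Otimes>\<^sub>M ?N)"
    unfolding norm_prod_def by measurable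
  have AE0: "AE \<xi> in (gauss :: 'a measure). \<xi> \<noteq> 0"
    using AE_gauss_coordinate_neq_0[OF SOME_Basis] by eventually_elim auto
  have "(\<integral>\<^sup>+\<eta>. ?h \<eta> \<partial>((gauss :: 'a measure) \<Otimes>\<^sub>M ?N)) = (\<integral>\<^sup>+\<xi>. \<integral>\<^sup>+\<tau>. ?h (\<xi>, \<tau>) \<partial>?N \<partial>gauss)"
    by (rule N.nn_integral_fst[symmetric]) measurable
  also have "\<dots> \<le> (\<integral>\<^sup>+\<xi>. ennreal (2 * K) * ennreal (norm \<xi> powr (- \<alpha>)) \<partial>(gauss :: 'a measure))"
  proof (rule nn_integral_mono_AE, use AE0 in eventually_elim)
    case (elim \<xi>)
    have "(\<integral>\<^sup>+\<tau>. ?h (\<xi>, \<tau>) \<partial>?N) \<le> (\<integral>\<^sup>+\<tau>. ennreal (norm \<xi> powr (- \<alpha>)) *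
        (ennreal (\<bar>\<tau> - norm \<xi>\<bar> powr (- ?\<gamma>)) + ennreal (\<bar>\<tau> - (- norm \<xi>)\<bar> powr (- ?\<gamma>))) \<partial>?N)"
      using ennreal_leI[OF key[OF elim]]
      by (intro nn_integral_mono) (simp add: ennreal_mult flip: ennreal_plus)
    also have "\<dots> = ennreal (norm \<xi> powr (- \<alpha>)) *
        ((\<integral>\<^sup>+\<tau>. ennreal (\<bar>\<tau> - norm \<xi>\<bar> powr (- ?\<gamma>)) \<partial>?N) + (\<integral>\<^sup>+\<tau>. ennreal (\<bar>\<tau> - (- norm \<xi>)\<bar> powr (- ?\<gamma>)) \<partial>?N))"
      by (subst nn_integral_cmult, simp, subst nn_integral_add) auto
    also have "\<dots> \<le> ennreal (norm \<xi> powr (- \<alpha>)) * (ennreal K + ennreal K)"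
      unfolding K_def using p less by (intro mult_left_mono add_mono nn_integral_std_normal_powr_le) auto
    also have "\<dots> = ennreal (2 * K) * ennreal (norm \<xi> powr (- \<alpha>))"
      using K0 by (simp add: mult.commute flip: ennreal_plus)
    finally show ?case .
  qed
  also have "\<dots> = ennreal (2 * K) * (\<integral>\<^sup>+\<xi>. ennreal (norm \<xi> powr (- \<alpha>)) \<partial>(gauss :: 'a measure))"
    by (rule nn_integral_cmult) simp
  also have "\<dots> < \<infinity>"
    using nn_integral_gauss_norm_powr_finite[OF p(3) less(2)] by (simp add: ennreal_mult_less_top)
  finally show ?thesis .
qed

section \<open>The upper bound\<close>

lemma norm_fourier_transform_le_1:
  assumes "prob_space M"
  shows "norm (fourier_transform M \<xi>) \<le> 1"
proof -
  interpret prob_space M by fact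
  have "norm (fourier_transform M \<xi>) \<le> (LINT x|M. 1)"
    unfolding fourier_transform_def by (rule norm_integral_le) auto
  then show ?thesis by (simp add: prob_space)
qed

lemma AE_cone_form_neq_0:
  "AE \<eta> in (gauss :: 'a::euclidean_space measure) \<Otimes>\<^sub>M std_normal_distribution. cone_form \<eta> \<noteq> 0"
proof -
  interpret g: prob_space "gauss :: 'a measure" by (rule prob_space_gauss)
  interpret N: prob_space std_normal_distribution by (rule prob_space_std_normal_distribution)
  interpret G: pair_prob_space "gauss :: 'a measure" std_normal_distribution ..
  show ?thesis
  proof (rule G.AE_pair_measure)
    show "{\<eta> \<in> space ((gauss :: 'a measure) \<Otimes>\<^sub>M std_normal_distribution). cone_form \<eta> \<noteq> 0}
        \<in> sets ((gauss :: 'a measure) \<Otimes>\<^sub>M std_normal_distribution)"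
      by measurable
    have "AE \<tau> in std_normal_distribution. cone_form (\<xi>, \<tau>) \<noteq> 0" for \<xi> :: 'a
      using AE_std_normal_neq[of "norm \<xi>"] AE_std_normal_neq[of "- norm \<xi>"]
      by eventually_elim (auto simp: cone_form_def power2_eq_iff)
    then show "AE \<xi> in (gauss :: 'a measure). AE \<tau> in std_normal_distribution. cone_form (\<xi>, \<tau>) \<noteq> 0" by simp
  qed
qed

text \<open>The pairing \<open>T R\<close> is evaluated in two ways. By
  \<open>cone_kernel_integral_limit\<close> it has exact order
  \<open>R powr (- (real d + 1) / 2)\<close> along the positive integers, whereas decay with
  \<open>s > real d - 1\<close> makes it smaller by a further power
  \<open>R powr (- (\<delta> / 8))\<close>.\<close>

lemma light_cone_fourier_decay_le:
  fixes \<mu> :: "('a::euclidean_space \<times> real) measure"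
  assumes \<mu>: "\<mu> \<in> borel_prob_on light_cone"
    and decay: "\<And>\<xi>. \<xi> \<noteq> 0 \<Longrightarrow> norm (fourier_transform \<mu> \<xi>) \<le> C * norm \<xi> powr (- s / 2)"
  shows "s \<le> real DIM('a) - 1"
proof (rule ccontr)
  assume "\<not> s \<le> real DIM('a) - 1"
  define d where "d = DIM('a)"
  \<comment> \<open>The excess of \<open>s\<close> over \<open>real d - 1\<close>, capped at 1 to
    keep \<open>\<theta>\<close> positive. Decay is used only with the weaker exponent
    \<open>p \<le> s / 2\<close>.\<close>
  define \<delta> where "\<delta> = min 1 (s - (real d - 1))"
  define p where "p = (real d - 1 + \<delta>) / 2"
  define \<theta> where "\<theta> = 1 - 3 * \<delta> / 8" \<comment> \<open>below 1 for integrability across the cone, yet \<open>p + \<theta> > (d + 1) / 2\<close>\<close>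
  \<comment> \<open>For norms at least 1 the exponent may be lowered to \<open>p\<close>; for
    smaller norms the trivial bound 1 takes over, whence the maximum with 1.\<close>
  define C' where "C' = max C 1"
  have d: "1 \<le> real d" by (simp add: d_def Suc_leI)
  have \<delta>: "0 < \<delta>" "\<delta> \<le> 1" "p \<le> s / 2"
  proof -
    show "0 < \<delta>" "\<delta> \<le> 1" using \<open>\<not> s \<le> real DIM('a) - 1\<close> by (auto simp: \<delta>_def d_def)
    have "\<delta> \<le> s - (real d - 1)" by (simp add: \<delta>_def)
    then show "p \<le> s / 2" by (simp add: p_def)
  qed
  have p0: "0 \<le> p" "0 \<le> \<theta>" "\<theta> \<le> 1" using d \<delta> by (auto simp: p_def \<theta>_def)
  have P\<mu>: "prob_space \<mu>" and s\<mu>: "sets \<mu> = sets borel"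
    using \<mu> unfolding borel_prob_on_def mem_Collect_eq by blast+
  let ?N = std_normal_distribution
  let ?G = "(gauss :: 'a measure) \<Otimes>\<^sub>M ?N"
  have C': "norm (fourier_transform \<mu> \<xi>) \<le> C' * norm \<xi> powr (- p)" if "\<xi> \<noteq> 0" for \<xi>
  proof (cases "1 \<le> norm \<xi>")
    case True
    have "norm (fourier_transform \<mu> \<xi>) \<le> C * norm \<xi> powr (- s / 2)" by (rule decay[OF that])
    also have "\<dots> \<le> C' * norm \<xi> powr (- p)"
      using True \<delta> by (intro mult_mono powr_mono) (auto simp: C'_def)
    finally show ?thesis .
  next
    case False
    have "norm (fourier_transform \<mu> \<xi>) \<le> 1 * 1" using norm_fourier_transform_le_1[OF P\<mu>] by simp
    also have "\<dots> \<le> C' * norm \<xi> powr (- p)"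
      using False that powr_mono2'[of "- p" "norm \<xi>" 1] p0 by (intro mult_mono) (auto simp: C'_def)
    finally show ?thesis .
  qed
  define h where "h \<eta> = norm \<eta> powr (- p) * \<bar>cone_form \<eta>\<bar> powr (- \<theta>)" for \<eta> :: "'a \<times> real"
  have [measurable]: "h \<in> borel_measurable ?G"
    unfolding h_def norm_prod_def by measurable
  have h: "integrable ?G h"
  proof (rule integrableI_nonneg)
    \<comment> \<open>With \<open>\<beta> = (1 - \<theta>) / 2\<close> the exponent
      \<open>\<alpha>\<close> equals \<open>(real d + 1) / 2 - \<delta> / 16\<close>, which is below
      \<open>real d\<close> even when \<open>d = 1\<close>.\<close>
    have "p + \<theta> - (1 - \<theta>) / 2 < real d" "0 \<le> p + \<theta> - (1 - \<theta>) / 2" "(1 - \<theta>) / 2 + \<theta> < 1"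
      using d \<delta> by (simp_all add: p_def \<theta>_def field_simps)
    with p0 show "(\<integral>\<^sup>+\<eta>. ennreal (h \<eta>) \<partial>?G) < \<infinity>"
      unfolding h_def d_def
      by (intro nn_integral_cone_weight_finite[where \<beta> = "(1 - \<theta>) / 2" and \<alpha> = "p + \<theta> - (1 - \<theta>) / 2"]) auto
  qed (auto simp: h_def)
  define K where "K = C' * (LINT \<eta>|?G. h \<eta>)"
  \<comment> \<open>The power \<open>Suc (Suc d)\<close> comes from the Gamma index
    \<open>Suc d\<close>, the least one that \<open>cone_kernel_integral_limit\<close>
    admits.\<close>
  define T where "T R = (LINT \<eta>|?G. fourier_transform \<mu> (R *\<^sub>R \<eta>) * (1 / Complex 1 (- (R * cone_form \<eta>)) ^ Suc (Suc d)))" for R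
  have T_le: "norm (T R) \<le> K * R powr (- p - \<theta>)" if R: "0 < R" for R
  proof -
    have "norm (T R) \<le> (LINT \<eta>|?G. (C' * R powr (- p - \<theta>)) * h \<eta>)"
      unfolding T_def
    proof (rule norm_integral_le_AE)
      show "integrable ?G (\<lambda>\<eta>. (C' * R powr (- p - \<theta>)) * h \<eta>)" using h by simp
      show "AE \<eta> in ?G. norm (fourier_transform \<mu> (R *\<^sub>R \<eta>) * (1 / Complex 1 (- (R * cone_form \<eta>)) ^ Suc (Suc d)))
          \<le> (C' * R powr (- p - \<theta>)) * h \<eta>"
        using AE_cone_form_neq_0
      proof eventually_elim
        case (elim \<eta>)
        then have \<eta>: "\<eta> \<noteq> 0" by (auto simp: cone_form_def)
        let ?q = "R * \<bar>cone_form \<eta>\<bar>" and ?w = "Complex 1 (- (R * cone_form \<eta>))"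
        have q: "0 < ?q" using R elim by simp
        have w: "1 \<le> norm ?w" "?q \<le> norm ?w"
          using abs_Re_le_cmod[of ?w] abs_Im_le_cmod[of ?w] R by (auto simp: abs_mult)
        \<comment> \<open>Since \<open>norm ?w \<ge> 1\<close>, its power can be reduced from
          \<open>d + 2\<close> to \<open>\<theta>\<close>, and then \<open>norm ?w\<close> replaced
          by the smaller \<open>?q\<close>.\<close>
        have "?q powr \<theta> \<le> norm ?w powr \<theta>" using w q p0 by (intro powr_mono2) auto
        also have "\<dots> \<le> norm ?w powr real (Suc (Suc d))" using w p0 by (intro powr_mono) auto
        also have "\<dots> = norm ?w ^ Suc (Suc d)" using w by (intro powr_realpow) linarith
        finally have "norm (1 / ?w ^ Suc (Suc d)) \<le> 1 / ?q powr \<theta>"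
          unfolding norm_divide norm_power using q w by (intro frac_le) auto
        moreover have "norm (fourier_transform \<mu> (R *\<^sub>R \<eta>)) \<le> C' * norm (R *\<^sub>R \<eta>) powr (- p)"
          using R \<eta> by (intro C') simp
        ultimately have "norm (fourier_transform \<mu> (R *\<^sub>R \<eta>) * (1 / ?w ^ Suc (Suc d)))
            \<le> (C' * norm (R *\<^sub>R \<eta>) powr (- p)) * (1 / ?q powr \<theta>)"
          unfolding norm_mult by (intro mult_mono) (auto simp: C'_def)
        also have "\<dots> = (C' * R powr (- p - \<theta>)) * h \<eta>"
          using R elim by (simp add: h_def powr_mult powr_diff powr_minus divide_simps)
        finally show ?case .
      qed
    qed
    then show ?thesis by (simp add: K_def mult_ac)
  qed
  obtain L where L: "L \<noteq> 0" "(\<lambda>n. of_real (sqrt (real (Suc n)) ^ Suc d) *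
        (LINT z|(\<mu> \<Otimes>\<^sub>M gamma_distribution (Suc d)). cone_kernel d (real (Suc n)) (snd z) (snd (fst z)))) \<longlonglongrightarrow> L"
    using cone_kernel_integral_limit[OF \<mu>, of d "Suc d"] by blast
  from L(2) have lim: "(\<lambda>n. of_real (sqrt (real (Suc n)) ^ Suc d) * T (real (Suc n))) \<longlonglongrightarrow> L"
    unfolding T_def fourier_transform_gauss_gamma_test[OF \<mu>] d_def .
  have "(\<lambda>n. of_real (sqrt (real (Suc n)) ^ Suc d) * T (real (Suc n))) \<longlonglongrightarrow> 0"
  proof (rule Lim_null_comparison)
    show "\<forall>\<^sub>F n in sequentially. norm (of_real (sqrt (real (Suc n)) ^ Suc d) * T (real (Suc n))) \<le> K * real (Suc n) powr (- (\<delta> / 8))"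
    proof (rule always_eventually, rule allI)
      fix n
      let ?R = "real (Suc n)"
      have "norm (complex_of_real (sqrt ?R ^ Suc d)) = sqrt ?R ^ Suc d"
        unfolding norm_of_real by (intro abs_of_nonneg zero_le_power) simp
      then have "norm (of_real (sqrt ?R ^ Suc d) * T ?R) \<le> sqrt ?R ^ Suc d * (K * ?R powr (- p - \<theta>))"
        unfolding norm_mult by (simp only:) (intro mult_left_mono T_le zero_le_power; simp)
      also have "\<dots> = K * ?R powr ((real d + 1) / 2 + (- p - \<theta>))"
      proof -
        have "sqrt ?R ^ Suc d = ?R powr ((real d + 1) / 2)"
          by (simp add: powr_half_sqrt[symmetric] powr_realpow[symmetric] powr_powr)
             (simp add: powr_add[symmetric] field_simps)
        then show ?thesis by (simp only: powr_add mult_ac)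
      qed
      \<comment> \<open>By the choice of the exponents, \<open>p + \<theta>\<close> exceeds
        \<open>(real d + 1) / 2\<close> by \<open>\<delta> / 8\<close>.\<close>
      also have "(real d + 1) / 2 + (- p - \<theta>) = - (\<delta> / 8)"
        by (simp add: p_def \<theta>_def field_simps)
      finally show "norm (of_real (sqrt ?R ^ Suc d) * T ?R) \<le> K * ?R powr (- (\<delta> / 8))" .
    qed
    have "(\<lambda>n. real (Suc n) powr (- (\<delta> / 8))) \<longlonglongrightarrow> 0"
      using \<delta> by (intro tendsto_neg_powr filterlim_compose[OF filterlim_real_sequentially filterlim_Suc]) auto
    then show "(\<lambda>n. K * real (Suc n) powr (- (\<delta> / 8))) \<longlonglongrightarrow> 0"
      by (rule tendsto_mult_right_zero)
  qed
  with lim L(1) show False using LIMSEQ_unique by blast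
qed

section \<open>A measure with good decay\<close>

text \<open>The chart takes \<open>DIM('a) - 1\<close> parameters. They are modelled in the
  hyperplane orthogonal to a basis vector \<open>e\<close> of \<open>'a\<close> itself, and the
  Gaussian coordinate along \<open>e\<close> contributes only a factor 1.\<close>

definition horizontal :: "'a::euclidean_space \<Rightarrow> 'a \<Rightarrow> 'a" where
  "horizontal e p = p - (p \<bullet> e) *\<^sub>R e"

lemma borel_measurable_horizontal [measurable]:
  assumes [measurable]: "f \<in> borel_measurable M"
  shows "(\<lambda>x. horizontal e (f x)) \<in> borel_measurable M"
  unfolding horizontal_def by measurable

lemma horizontal_inner_Basis:
  "e \<in> Basis \<Longrightarrow> b \<in> Basis \<Longrightarrow> horizontal e p \<bullet> b = (if b = e then 0 else p \<bullet> b)"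
  by (auto simp: horizontal_def inner_diff_left inner_Basis)

lemma horizontal_inner_self: "e \<in> Basis \<Longrightarrow> horizontal e p \<bullet> e = 0"
  by (simp add: horizontal_inner_Basis)

lemma inner_horizontal: "e \<in> Basis \<Longrightarrow> x \<bullet> horizontal e p = horizontal e x \<bullet> horizontal e p"
  by (simp add: horizontal_def inner_diff_left inner_diff_right algebra_simps inner_commute)

lemma inner_horizontal_sum:
  assumes e: "e \<in> Basis"
  shows "horizontal e x \<bullet> horizontal e p = (\<Sum>b\<in>Basis. if b = e then 0 else (x \<bullet> b) * (p \<bullet> b))"
  by (subst euclidean_inner) (auto intro!: sum.cong simp: horizontal_inner_Basis e)

lemma norm_horizontal_le:
  assumes e: "e \<in> Basis"
  shows "norm (horizontal e p) \<le> norm p"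
proof -
  have "(norm (horizontal e p))\<^sup>2 \<le> (norm p)\<^sup>2"
    unfolding norm_power2_Basis by (intro sum_mono) (auto simp: horizontal_inner_Basis e)
  then show ?thesis by simp
qed

text \<open>Inverse stereographic projection of the unit sphere, cleared of its denominator and
  multiplied by \<open>snd z\<close>. Pairing with a frequency then gives a quadratic polynomial in
  the parameter, linear in \<open>snd z\<close>.\<close>

definition cone_chart :: "'a::euclidean_space \<Rightarrow> 'a \<times> real \<Rightarrow> 'a \<times> real" where
  "cone_chart e z = snd z *\<^sub>R (2 *\<^sub>R horizontal e (fst z) + ((norm (horizontal e (fst z)))\<^sup>2 - 1) *\<^sub>R e,
     (norm (horizontal e (fst z)))\<^sup>2 + 1)"

text \<open>The quadratic polynomial in question, see \<open>inner_cone_chart\<close>. The decay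
  estimates distinguish which of its constant, linear and quadratic coefficients is large.\<close>

definition cone_phase :: "'a::euclidean_space \<Rightarrow> 'a \<times> real \<Rightarrow> 'a \<Rightarrow> real" where
  "cone_phase e \<xi> p = (snd \<xi> - fst \<xi> \<bullet> e) + 2 * (fst \<xi> \<bullet> horizontal e p)
     + (snd \<xi> + fst \<xi> \<bullet> e) * (norm (horizontal e p))\<^sup>2"

lemma borel_measurable_cone_phase [measurable]: "cone_phase e \<xi> \<in> borel_measurable borel"
  unfolding cone_phase_def by measurable

lemma inner_cone_chart: "\<xi> \<bullet> cone_chart e (p, u) = u * cone_phase e \<xi> p"
  by (simp add: cone_chart_def cone_phase_def inner_prod_def inner_add_right algebra_simps)

lemma cone_chart_in_light_cone:
  assumes e: "e \<in> Basis"
  shows "cone_chart e z \<in> light_cone"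
proof -
  let ?h = "horizontal e (fst z)"
  let ?v = "2 *\<^sub>R ?h + ((norm ?h)\<^sup>2 - 1) *\<^sub>R e"
  have he: "?h \<bullet> e = 0" by (rule horizontal_inner_self[OF e])
  then have eh: "e \<bullet> ?h = 0" by (subst inner_commute)
  have ee: "e \<bullet> e = 1" using e by simp
  have "(norm ?v)\<^sup>2 = 4 * (norm ?h)\<^sup>2 + ((norm ?h)\<^sup>2 - 1) * ((norm ?h)\<^sup>2 - 1)"
    unfolding power2_norm_eq_inner[of ?v] inner_add_left inner_add_right inner_scaleR_left inner_scaleR_right he eh ee
    by (simp add: power2_norm_eq_inner)
  also have "\<dots> = ((norm ?h)\<^sup>2 + 1)\<^sup>2" by (simp add: power2_eq_square algebra_simps)
  finally have "(norm ?v)\<^sup>2 = ((norm ?h)\<^sup>2 + 1)\<^sup>2" .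
  then have "norm ?v = (norm ?h)\<^sup>2 + 1"
    by (rule power2_eq_imp_eq) simp_all
  moreover have "norm (snd z *\<^sub>R ?v) = \<bar>snd z\<bar> * norm ?v" by (rule norm_scaleR)
  ultimately show ?thesis
    by (simp only: light_cone_def cone_chart_def mem_Collect_eq prod.case) (simp add: abs_mult)
qed

lemma borel_measurable_cone_chart [measurable]:
  "cone_chart e \<in> borel_measurable (borel \<Otimes>\<^sub>M borel)"
proof -
  have "(\<lambda>z. (snd z *\<^sub>R (2 *\<^sub>R horizontal e (fst z) + ((norm (horizontal e (fst z)))\<^sup>2 - 1) *\<^sub>R e),
      snd z * ((norm (horizontal e (fst z)))\<^sup>2 + 1))) \<in> measurable (borel \<Otimes>\<^sub>M borel) (borel \<Otimes>\<^sub>M borel)"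
    by measurable
  then show ?thesis
    by (simp add: cone_chart_def[abs_def] borel_prod)
qed

definition cone_measure :: "'a::euclidean_space \<Rightarrow> nat \<Rightarrow> ('a \<times> real) measure" where
  "cone_measure e k = distr (gauss \<Otimes>\<^sub>M gamma_distribution k) borel (cone_chart e)"

lemma closed_light_cone: "closed (light_cone :: ('a::euclidean_space \<times> real) set)"
proof -
  have "light_cone = {z :: 'a \<times> real. norm (fst z) = \<bar>snd z\<bar>}" by (auto simp: light_cone_def)
  also have "closed \<dots>" by (intro closed_Collect_eq continuous_intros)
  finally show ?thesis .
qed

lemma cone_measure_in_borel_prob_on:
  assumes e: "e \<in> Basis"
  shows "cone_measure e k \<in> borel_prob_on light_cone"
proof -
  interpret g: prob_space gauss by (rule prob_space_gauss)
  interpret E: prob_space "gamma_distribution k" by (rule prob_space_gamma_distribution)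
  interpret G: pair_prob_space gauss "gamma_distribution k" ..
  have m: "cone_chart e \<in> measurable (gauss \<Otimes>\<^sub>M gamma_distribution k) borel" by measurable
  have "prob_space (cone_measure e k)"
    unfolding cone_measure_def by (rule G.prob_space_distr[OF m])
  moreover have "emeasure (cone_measure e k) light_cone = 1"
    unfolding cone_measure_def
    using cone_chart_in_light_cone[OF e] borel_closed[OF closed_light_cone] m
    by (subst emeasure_distr) (auto simp: vimage_def G.emeasure_space_1)
  ultimately show ?thesis
    using borel_closed[OF closed_light_cone] by (simp add: borel_prob_on_def cone_measure_def)
qed

section \<open>Decay from curvature\<close>

text \<open>Two orders of integration: with the Gaussian integral inside the curvature becomes
  visible, with the Gamma integral inside a high negative power of the phase appears.\<close>

lemma fourier_transform_cone_measure:
  fixes e :: "'a::euclidean_space"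
  shows "fourier_transform (cone_measure e k) \<xi>
      = (LINT u|gamma_distribution k. LINT p|gauss. cis (- 2 * pi * (u * cone_phase e \<xi> p)))" (is "_ = ?A")
    and "fourier_transform (cone_measure e k) \<xi>
      = (LINT p|gauss. 1 / Complex 1 (2 * pi * cone_phase e \<xi> p) ^ Suc k)" (is "_ = ?B")
proof -
  let ?E = "gamma_distribution k"
  interpret g: prob_space "gauss :: 'a measure" by (rule prob_space_gauss)
  interpret E: prob_space ?E by (rule prob_space_gamma_distribution)
  interpret G: pair_prob_space "gauss :: 'a measure" ?E ..
  let ?f = "\<lambda>p u. cis (- 2 * pi * (u * cone_phase e \<xi> p))"
  have m: "case_prod ?f \<in> borel_measurable ((gauss :: 'a measure) \<Otimes>\<^sub>M ?E)"
    unfolding cis_conv_exp by measurable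
  have int: "integrable ((gauss :: 'a measure) \<Otimes>\<^sub>M ?E) (case_prod ?f)"
    using m by (rule G.integrable_const_bound[of _ 1, rotated]) (simp add: split_beta)
  have "fourier_transform (cone_measure e k) \<xi> = (LINT z|((gauss :: 'a measure) \<Otimes>\<^sub>M ?E). cis (- 2 * pi * (\<xi> \<bullet> cone_chart e z)))"
    unfolding fourier_transform_def cone_measure_def
    by (rule integral_distr) (auto simp: cis_conv_exp)
  also have "\<dots> = integral\<^sup>L ((gauss :: 'a measure) \<Otimes>\<^sub>M ?E) (case_prod ?f)"
    by (intro Bochner_Integration.integral_cong refl) (auto simp: inner_cone_chart)
  finally have *: "fourier_transform (cone_measure e k) \<xi> = integral\<^sup>L ((gauss :: 'a measure) \<Otimes>\<^sub>M ?E) (case_prod ?f)" .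
  from * show "fourier_transform (cone_measure e k) \<xi> = ?A"
    unfolding G.integral_snd[OF int] .
  have "(LINT u|?E. ?f p u) = 1 / Complex 1 (2 * pi * cone_phase e \<xi> p) ^ Suc k" for p
    using char_gamma_distribution[where \<theta> = "- 2 * pi * cone_phase e \<xi> p" and k = k] by (simp add: mult_ac)
  with * show "fourier_transform (cone_measure e k) \<xi> = ?B"
    unfolding G.integral_fst[OF int, symmetric] by simp
qed

text \<open>The integral factors over coordinates; the one along \<open>e\<close> gives 1 and each
  of the other \<open>DIM('a) - 1\<close> gives a Gaussian factor with parameter
  \<open>Complex 1 (- 2 * w)\<close>.\<close>

lemma norm_integral_gauss_horizontal:
  fixes e y :: "'a::euclidean_space"
  assumes e: "e \<in> Basis"
  shows "norm (LINT p|gauss. cis (a + (w * (norm (horizontal e p))\<^sup>2 + horizontal e y \<bullet> horizontal e p)))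
    = exp (- (norm (horizontal e y))\<^sup>2 / (2 * (norm (Complex 1 (- 2 * w)))\<^sup>2)) / sqrt (norm (Complex 1 (- 2 * w))) ^ (DIM('a) - 1)"
proof -
  let ?\<zeta> = "Complex 1 (- 2 * w)"
  let ?f = "\<lambda>b x. if b = e then 1 else cis (w * x\<^sup>2 + (y \<bullet> b) * x)"
  let ?g = "\<lambda>b. exp (- (of_real (y \<bullet> b))\<^sup>2 / (2 * ?\<zeta>)) / csqrt ?\<zeta>"
  interpret N: prob_space std_normal_distribution by (rule prob_space_std_normal_distribution)
  have "cis (w * (norm (horizontal e p))\<^sup>2 + horizontal e y \<bullet> horizontal e p) = (\<Prod>b\<in>Basis. ?f b (p \<bullet> b))" for p
  proof -
    have "w * (norm (horizontal e p))\<^sup>2 + horizontal e y \<bullet> horizontal e p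
        = (\<Sum>b\<in>Basis. if b = e then 0 else w * (p \<bullet> b)\<^sup>2 + (y \<bullet> b) * (p \<bullet> b))"
      unfolding power2_norm_eq_inner inner_horizontal_sum[OF e] sum_distrib_left sum.distrib[symmetric]
      by (intro sum.cong) (auto simp: power2_eq_square)
    then show ?thesis by (simp add: cis_sum if_distrib[of cis] cong: if_cong)
  qed
  then have "(LINT p|gauss. cis (a + (w * (norm (horizontal e p))\<^sup>2 + horizontal e y \<bullet> horizontal e p)))
      = cis a * (LINT p|gauss. (\<Prod>b\<in>Basis. ?f b (p \<bullet> b)))"
    unfolding cis_mult[symmetric] by simp
  also have "(LINT p|gauss. (\<Prod>b\<in>Basis. ?f b (p \<bullet> b))) = (\<Prod>b\<in>Basis. LINT x|std_normal_distribution. ?f b x)"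
  proof (rule integral_gauss_prod[of ?f])
    show "integrable std_normal_distribution (?f b)" for b
      using integrable_cis_prob[OF prob_space_std_normal_distribution, of "\<lambda>x. w * x\<^sup>2 + (y \<bullet> b) * x"]
      by (cases "b = e") auto
  qed
  also have "\<dots> = (\<Prod>b\<in>Basis. if b = e then 1 else ?g b)"
    by (intro prod.cong refl) (auto simp: integral_std_normal_quadratic_phase N.prob_space[simplified])
  also have "\<dots> = (\<Prod>b\<in>Basis - {e}. ?g b)"
    using e by (simp add: prod.remove)
  finally have "norm (LINT p|gauss. cis (a + (w * (norm (horizontal e p))\<^sup>2 + horizontal e y \<bullet> horizontal e p)))
      = (\<Prod>b\<in>Basis - {e}. norm (?g b))"
    by (simp add: norm_mult prod_norm)
  also have "\<dots> = (\<Prod>b\<in>Basis - {e}. exp (- (y \<bullet> b)\<^sup>2 / (2 * (norm ?\<zeta>)\<^sup>2)) / sqrt (norm ?\<zeta>))"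
  proof (rule prod.cong[OF refl])
    fix b
    \<comment> \<open>As \<open>?\<zeta>\<close> has real part 1, the real part of its reciprocal is
      one over its squared modulus.\<close>
    have "Re (- (of_real (y \<bullet> b))\<^sup>2 / (2 * ?\<zeta>)) = - (y \<bullet> b)\<^sup>2 / (2 * (norm ?\<zeta>)\<^sup>2)"
    proof -
      have "2 + 8 * w\<^sup>2 \<noteq> 0" "4 + w\<^sup>2 * 16 \<noteq> 0" by (smt (verit) zero_le_power2)+
      then show ?thesis
        by (simp add: Re_divide cmod_power2 power2_eq_square[of "2::real"] power_mult_distrib) (simp add: field_simps)
    qed
    then show "norm (?g b) = exp (- (y \<bullet> b)\<^sup>2 / (2 * (norm ?\<zeta>)\<^sup>2)) / sqrt (norm ?\<zeta>)"
      by (simp only: norm_divide norm_exp_eq_Re norm_csqrt)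
  qed
  also have "\<dots> = exp (\<Sum>b\<in>Basis - {e}. - (y \<bullet> b)\<^sup>2 / (2 * (norm ?\<zeta>)\<^sup>2)) / sqrt (norm ?\<zeta>) ^ (DIM('a) - 1)"
    using e by (simp add: prod_dividef exp_sum)
  also have "(\<Sum>b\<in>Basis - {e}. - (y \<bullet> b)\<^sup>2 / (2 * (norm ?\<zeta>)\<^sup>2)) = - (norm (horizontal e y))\<^sup>2 / (2 * (norm ?\<zeta>)\<^sup>2)"
  proof -
    have "(norm (horizontal e y))\<^sup>2 = (\<Sum>b\<in>Basis - {e}. (y \<bullet> b)\<^sup>2)"
      unfolding power2_norm_eq_inner inner_horizontal_sum[OF e]
      using e by (subst sum.remove[of _ e]) (auto simp: power2_eq_square intro!: sum.cong)
    then show ?thesis by (simp add: sum_negf sum_divide_distrib)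
  qed
  finally show ?thesis .
qed

lemma sqrt_power_le_exp:
  assumes "0 \<le> (x::real)"
  shows "sqrt x ^ q \<le> (1 + 2 ^ q * fact q) * exp (x\<^sup>2 / 2)"
proof -
  have e1: "1 \<le> exp (x\<^sup>2 / 2)" by simp
  have "(x\<^sup>2 / 2) ^ q / fact q \<le> exp (x\<^sup>2 / 2)"
    using sum_le_suminf[OF summable_exp, of "{q}" "x\<^sup>2 / 2"] by (simp add: exp_def inverse_eq_divide)
  then have e2: "(x\<^sup>2) ^ q \<le> 2 ^ q * fact q * exp (x\<^sup>2 / 2)"
    by (simp add: power_divide field_simps)
  have "sqrt x ^ q \<le> 1 + (x\<^sup>2) ^ q"
  proof (cases "x \<le> 1")
    case True
    then have "sqrt x ^ q \<le> 1" using assms by (intro power_le_one) auto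
    then show ?thesis by (smt (verit) zero_le_power zero_le_power2)
  next
    case False
    then have "sqrt x \<le> x\<^sup>2"
      using real_sqrt_le_mono[of x "x\<^sup>2"] self_le_power[of x 2] assms by (auto simp: real_sqrt_abs)
    then have "sqrt x ^ q \<le> (x\<^sup>2) ^ q" using assms by (intro power_mono) auto
    then show ?thesis by simp
  qed
  with e1 e2 show ?thesis unfolding distrib_right by linarith
qed

text \<open>The bound is uniform in \<open>m\<close>: if \<open>m\<close> is small against
  \<open>V\<close> the exponential wins, otherwise the denominator does. Scaling reduces it to the
  single variable \<open>V / m\<close>.\<close>

lemma gaussian_decay_le:
  fixes V m :: real
  assumes V: "0 < V" and m: "0 < m"
  shows "exp (- V\<^sup>2 / (2 * m\<^sup>2)) / sqrt m ^ q \<le> (1 + 2 ^ q * fact q) / sqrt V ^ q"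
proof -
  have "sqrt V ^ q / sqrt m ^ q = sqrt (V / m) ^ q" by (simp add: power_divide real_sqrt_divide)
  also have "\<dots> \<le> (1 + 2 ^ q * fact q) * exp ((V / m)\<^sup>2 / 2)"
    using V m by (intro sqrt_power_le_exp) simp
  also have "(V / m)\<^sup>2 / 2 = V\<^sup>2 / (2 * m\<^sup>2)" by (simp add: power_divide)
  finally have "exp (- (V\<^sup>2 / (2 * m\<^sup>2))) * (sqrt V ^ q / sqrt m ^ q) \<le> exp (- (V\<^sup>2 / (2 * m\<^sup>2))) * ((1 + 2 ^ q * fact q) * exp (V\<^sup>2 / (2 * m\<^sup>2)))"
    by (intro mult_left_mono) auto
  also have "\<dots> = 1 + 2 ^ q * fact q" by (simp add: exp_minus)
  finally have "exp (- (V\<^sup>2 / (2 * m\<^sup>2))) * (sqrt V ^ q / sqrt m ^ q) / sqrt V ^ q \<le> (1 + 2 ^ q * fact q) / sqrt V ^ q"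
    using V by (intro divide_right_mono) auto
  then show ?thesis using V by simp
qed

text \<open>If the linear or the quadratic coefficient of the phase is at least \<open>B\<close>,
  the Gaussian integral for fixed \<open>u\<close> is of order
  \<open>(u * B) powr (- q / 2)\<close>. The singularity at \<open>u = 0\<close> is integrable for
  the Gamma law because \<open>q \<le> k\<close>.\<close>

lemma fourier_transform_cone_measure_curvature:
  fixes e :: "'a::euclidean_space"
  assumes e: "e \<in> Basis" and q: "q = DIM('a) - 1" "q \<le> k"
  obtains C where "0 < C" "\<And>\<xi> B. 0 < B \<Longrightarrow> B \<le> norm (horizontal e (fst \<xi>)) \<or> B \<le> \<bar>snd \<xi> + fst \<xi> \<bullet> e\<bar>
    \<Longrightarrow> norm (fourier_transform (cone_measure e k) \<xi>) \<le> C / sqrt B ^ q"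
proof
  let ?E = "gamma_distribution k"
  interpret E: prob_space ?E by (rule prob_space_gamma_distribution)
  define D where "D = 1 + 2 ^ q * (fact q :: real)"
  define I where "I = (LINT u|?E. 1 + inverse (u ^ q))"
  have D: "1 \<le> D" by (simp add: D_def)
  have int: "integrable ?E (\<lambda>u. 1 + inverse (u ^ q))"
    using integrable_gamma_distribution_inverse_power[OF q(2)] by simp
  have "(LINT u|?E. 1) \<le> I" unfolding I_def
    by (intro integral_mono_AE int) (auto intro!: eventually_mono[OF AE_gamma_distribution_pos])
  then have I: "1 \<le> I" using E.prob_space by simp
  show "0 < D * I" using D I by simp
  fix \<xi> :: "'a \<times> real" and B :: real
  let ?y = "horizontal e (fst \<xi>)" and ?c = "snd \<xi> + fst \<xi> \<bullet> e"
  assume B: "0 < B" "B \<le> norm ?y \<or> B \<le> \<bar>?c\<bar>"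
  have u: "norm (LINT p|gauss. cis (- 2 * pi * (u * cone_phase e \<xi> p))) \<le> D / sqrt B ^ q * (1 + inverse (u ^ q))"
    if u: "0 < u" for u
  proof -
    \<comment> \<open>The quadratic and linear coefficients of the phase times
      \<open>- 2 * pi * u\<close>; the linear one carries the additional factor 2 of
      \<open>cone_phase\<close>.\<close>
    let ?w = "- 2 * pi * u * ?c" and ?v = "(- 4 * pi * u) *\<^sub>R fst \<xi>"
    let ?m = "norm (Complex 1 (- 2 * ?w))"
    have hv: "horizontal e ?v = (- 4 * pi * u) *\<^sub>R ?y" by (simp add: horizontal_def algebra_simps)
    have "- 2 * pi * (u * cone_phase e \<xi> p) = - 2 * pi * u * (snd \<xi> - fst \<xi> \<bullet> e)
        + (?w * (norm (horizontal e p))\<^sup>2 + horizontal e ?v \<bullet> horizontal e p)" for p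
      unfolding hv cone_phase_def inner_horizontal[OF e, of "fst \<xi>" p] by (simp add: algebra_simps)
    then have "norm (LINT p|gauss. cis (- 2 * pi * (u * cone_phase e \<xi> p)))
        = exp (- (norm (horizontal e ?v))\<^sup>2 / (2 * ?m\<^sup>2)) / sqrt ?m ^ q"
      unfolding q(1) by (simp only: norm_integral_gauss_horizontal[OF e])
    also have "\<dots> \<le> D / sqrt (u * B) ^ q"
      \<comment> \<open>A large linear coefficient acts through the Gaussian exponential, a large
        quadratic one through the modulus \<open>?m\<close> in the denominator.\<close>
      using B(2)
    proof
      assume "B \<le> norm ?y"
      have "u * B \<le> u * norm ?y * (4 * pi)"
        using \<open>B \<le> norm ?y\<close> u B(1) pi_gt3 mult_mono[of "u * B" "u * norm ?y" 1 "4 * pi"] by auto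
      then have le: "u * B \<le> norm (horizontal e ?v)" using u unfolding hv norm_scaleR by (simp add: abs_mult mult_ac)
      have uB: "0 < u * B" using u B(1) by simp
      with le have vpos: "0 < norm (horizontal e ?v)" by linarith
      have "1 \<le> ?m" using abs_Re_le_cmod[of "Complex 1 (- 2 * ?w)"] by simp
      then have "exp (- (norm (horizontal e ?v))\<^sup>2 / (2 * ?m\<^sup>2)) / sqrt ?m ^ q \<le> D / sqrt (norm (horizontal e ?v)) ^ q"
        unfolding D_def using vpos by (intro gaussian_decay_le) linarith+
      also have "\<dots> \<le> D / sqrt (u * B) ^ q"
        using le uB vpos D by (intro divide_left_mono power_mono) auto
      finally show ?thesis .
    next
      assume "B \<le> \<bar>?c\<bar>"
      have "u * B \<le> u * \<bar>?c\<bar> * (4 * pi)"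
        using \<open>B \<le> \<bar>?c\<bar>\<close> u B(1) pi_gt3 mult_mono[of "u * B" "u * \<bar>?c\<bar>" 1 "4 * pi"] by auto
      also have "\<dots> = \<bar>Im (Complex 1 (- 2 * ?w))\<bar>"
      proof -
        have "u * \<bar>c\<bar> * (4 * pi) = \<bar>- 2 * (- 2 * pi * u * c)\<bar>" for c
          using u by (simp add: abs_mult mult_ac)
        then show ?thesis unfolding complex.sel .
      qed
      also have "\<dots> \<le> ?m" by (rule abs_Im_le_cmod)
      finally have le: "u * B \<le> ?m" .
      have uB: "0 < u * B" using u B(1) by simp
      have "exp (- (norm (horizontal e ?v))\<^sup>2 / (2 * ?m\<^sup>2)) / sqrt ?m ^ q \<le> D / sqrt (u * B) ^ q"
      proof (intro frac_le power_mono)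
        have "exp (- (norm (horizontal e ?v))\<^sup>2 / (2 * ?m\<^sup>2)) \<le> 1" by simp
        then show "exp (- (norm (horizontal e ?v))\<^sup>2 / (2 * ?m\<^sup>2)) \<le> D" using D by linarith
      qed (use le uB D in auto)
      then show ?thesis .
    qed
    also have "\<dots> = D / sqrt B ^ q * (1 / sqrt u ^ q)" by (simp add: real_sqrt_mult power_mult_distrib)
    also have "\<dots> \<le> D / sqrt B ^ q * (1 + inverse (u ^ q))"
      using D B(1) by (intro mult_left_mono inverse_sqrt_power_le u) auto
    finally show ?thesis .
  qed
  have "norm (fourier_transform (cone_measure e k) \<xi>) \<le> (LINT u|?E. D / sqrt B ^ q * (1 + inverse (u ^ q)))"
    unfolding fourier_transform_cone_measure(1)
  proof (rule norm_integral_le_AE)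
    show "integrable ?E (\<lambda>u. D / sqrt B ^ q * (1 + inverse (u ^ q)))" using int by (rule integrable_mult_right)
    show "AE u in ?E. norm (LINT p|gauss. cis (- 2 * pi * (u * cone_phase e \<xi> p))) \<le> D / sqrt B ^ q * (1 + inverse (u ^ q))"
      using AE_gamma_distribution_pos by eventually_elim (rule u)
  qed
  also have "\<dots> = D * I / sqrt B ^ q" unfolding I_def by (subst integral_mult_right_zero) simp
  finally show "norm (fourier_transform (cone_measure e k) \<xi>) \<le> D * I / sqrt B ^ q" .
qed

section \<open>Decay from a large constant coefficient\<close>

text \<open>Bounds a polynomial weight in the norm by a product over coordinates, to which
  \<open>nn_integral_gauss_prod\<close> applies.\<close>

lemma one_plus_sum_le_prod:
  fixes f :: "'a \<Rightarrow> real"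
  assumes "finite A" "\<And>x. x \<in> A \<Longrightarrow> 0 \<le> f x"
  shows "1 + sum f A \<le> (\<Prod>x\<in>A. 1 + f x)"
  using assms
proof (induction A rule: finite_induct)
  case (insert x A)
  have "1 + sum f (insert x A) = (1 + sum f A) + f x * 1" using insert by simp
  also have "\<dots> \<le> (\<Prod>x\<in>A. 1 + f x) + f x * (\<Prod>x\<in>A. 1 + f x)"
    using insert by (intro add_mono mult_left_mono prod_ge_1) auto
  finally show ?case using insert by (simp add: algebra_simps)
qed simp

lemma integrable_std_normal_polynomial_weight: "integrable std_normal_distribution (\<lambda>x. (1 + x\<^sup>2) ^ M)"
proof (subst integrable_density)
  show "integrable lborel (\<lambda>x. std_normal_density x *\<^sub>R (1 + x\<^sup>2) ^ M)"
  proof (rule Bochner_Integration.integrable_bound)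
    show "integrable lborel (\<lambda>x. 2 ^ M * (std_normal_density x + std_normal_density x * \<bar>x\<bar> ^ (2 * M)))"
      by (intro integrable_mult_right Bochner_Integration.integrable_add integrable_std_normal_moment_abs) simp
    have "(1 + x\<^sup>2) ^ M \<le> 2 ^ M * (1 + \<bar>x\<bar> ^ (2 * M))" for x :: real
    proof (cases "x\<^sup>2 \<le> 1")
      case True
      then have "(1 + x\<^sup>2) ^ M \<le> 2 ^ M" by (intro power_mono) auto
      also have "\<dots> \<le> 2 ^ M * (1 + \<bar>x\<bar> ^ (2 * M))" by simp
      finally show ?thesis .
    next
      case False
      then have "(1 + x\<^sup>2) ^ M \<le> (2 * x\<^sup>2) ^ M" by (intro power_mono) auto
      also have "\<dots> \<le> 2 ^ M * (1 + \<bar>x\<bar> ^ (2 * M))" by (simp add: power_mult power_mult_distrib)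
      finally show ?thesis .
    qed
    then have "std_normal_density x * (1 + x\<^sup>2) ^ M \<le> std_normal_density x * (2 ^ M * (1 + \<bar>x\<bar> ^ (2 * M)))" for x
      by (intro mult_left_mono) auto
    then show "AE x in lborel. norm (std_normal_density x *\<^sub>R (1 + x\<^sup>2) ^ M)
        \<le> norm (2 ^ M * (std_normal_density x + std_normal_density x * \<bar>x\<bar> ^ (2 * M)))"
      by (intro AE_I2) (simp add: abs_mult algebra_simps)
  qed simp
qed auto

lemma integrable_gauss_polynomial_weight:
  "integrable (gauss :: 'a::euclidean_space measure) (\<lambda>p. (1 + (norm p)\<^sup>2) ^ M)"
proof (rule integrableI_nonneg)
  have "(\<integral>\<^sup>+p. ennreal ((1 + (norm p)\<^sup>2) ^ M) \<partial>(gauss :: 'a measure))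
      \<le> (\<integral>\<^sup>+p. (\<Prod>b\<in>Basis. ennreal ((1 + (p \<bullet> b)\<^sup>2) ^ M)) \<partial>(gauss :: 'a measure))"
  proof (rule nn_integral_mono)
    fix p :: 'a
    have "(1 + (norm p)\<^sup>2) ^ M \<le> (\<Prod>b\<in>Basis. 1 + (p \<bullet> b)\<^sup>2) ^ M"
      unfolding norm_power2_Basis by (intro power_mono one_plus_sum_le_prod add_nonneg_nonneg sum_nonneg) auto
    then show "ennreal ((1 + (norm p)\<^sup>2) ^ M) \<le> (\<Prod>b\<in>Basis. ennreal ((1 + (p \<bullet> b)\<^sup>2) ^ M))"
      by (simp add: prod_ennreal prod_power_distrib ennreal_leI)
  qed
  also have "\<dots> = (\<Prod>b\<in>(Basis :: 'a set). \<integral>\<^sup>+x. ennreal ((1 + x\<^sup>2) ^ M) \<partial>std_normal_distribution)"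
    by (rule nn_integral_gauss_prod) auto
  also have "\<dots> < \<infinity>"
  proof -
    have "(\<integral>\<^sup>+x. ennreal ((1 + x\<^sup>2) ^ M) \<partial>std_normal_distribution) < \<infinity>"
      using integrable_std_normal_polynomial_weight[of M] unfolding integrable_iff_bounded by simp
    then show ?thesis by (simp add: power_less_top_ennreal)
  qed
  finally show "(\<integral>\<^sup>+p. ennreal ((1 + (norm p)\<^sup>2) ^ M) \<partial>(gauss :: 'a measure)) < \<infinity>" .
qed auto

text \<open>When the constant coefficient is at least \<open>a\<close> and the others at most
  \<open>B\<close>, the phase can drop below \<open>a / 2\<close> only for large \<open>p\<close>.
  The first summand handles a large phase; the second is a Chebyshev bound for large
  \<open>p\<close>, with \<open>G\<close> a Gaussian moment.\<close>

lemma fourier_transform_cone_measure_nonstationary: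
  fixes e :: "'a::euclidean_space"
  assumes e: "e \<in> Basis"
  obtains G where "0 \<le> G" "\<And>\<xi> a B. 0 < a \<Longrightarrow> a \<le> \<bar>snd \<xi> - fst \<xi> \<bullet> e\<bar> \<Longrightarrow> norm (horizontal e (fst \<xi>)) \<le> B
    \<Longrightarrow> \<bar>snd \<xi> + fst \<xi> \<bullet> e\<bar> \<le> B
    \<Longrightarrow> norm (fourier_transform (cone_measure e k) \<xi>) \<le> (2 / a) ^ Suc k + (4 * B / a) ^ Suc k * G"
proof
  let ?G = "LINT p|(gauss :: 'a measure). (1 + (norm p)\<^sup>2) ^ Suc k"
  interpret g: prob_space "gauss :: 'a measure" by (rule prob_space_gauss)
  show "0 \<le> ?G" by (rule Bochner_Integration.integral_nonneg) auto
  fix \<xi> :: "'a \<times> real" and a B :: real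
  assume a: "0 < a" "a \<le> \<bar>snd \<xi> - fst \<xi> \<bullet> e\<bar>" and B: "norm (horizontal e (fst \<xi>)) \<le> B" "\<bar>snd \<xi> + fst \<xi> \<bullet> e\<bar> \<le> B"
  have B0: "0 \<le> B" using B(1) norm_ge_zero order_trans by blast
  have le: "norm (1 / Complex 1 (2 * pi * cone_phase e \<xi> p) ^ Suc k) \<le> (2 / a) ^ Suc k + (4 * B / a) ^ Suc k * (1 + (norm p)\<^sup>2) ^ Suc k" for p
  proof -
    let ?f = "cone_phase e \<xi> p" and ?h = "horizontal e p"
    let ?z = "Complex 1 (2 * pi * ?f)"
    have nz: "norm (1 / ?z ^ Suc k) = (1 / norm ?z) ^ Suc k"
      unfolding norm_divide norm_power norm_one power_divide power_one ..
    have z: "1 \<le> norm ?z" "\<bar>?f\<bar> \<le> norm ?z"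
    proof -
      show "1 \<le> norm ?z" using abs_Re_le_cmod[of ?z] by simp
      have "\<bar>?f\<bar> \<le> (2 * pi) * \<bar>?f\<bar>" using pi_gt3 mult_right_mono[of 1 "2 * pi" "\<bar>?f\<bar>"] by simp
      also have "\<dots> \<le> norm ?z" using abs_Im_le_cmod[of ?z] by (simp add: abs_mult)
      finally show "\<bar>?f\<bar> \<le> norm ?z" .
    qed
    have "\<bar>fst \<xi> \<bullet> ?h\<bar> \<le> B * norm ?h"
      by (subst inner_horizontal[OF e], rule order_trans[OF Cauchy_Schwarz_ineq2]) (intro mult_right_mono B norm_ge_zero)
    moreover have "\<bar>(snd \<xi> + fst \<xi> \<bullet> e) * (norm ?h)\<^sup>2\<bar> \<le> B * (norm ?h)\<^sup>2"
      using mult_right_mono[OF B(2), of "(norm ?h)\<^sup>2"] by (simp add: abs_mult)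
    ultimately have "a \<le> \<bar>?f\<bar> + B * (2 * norm ?h + (norm ?h)\<^sup>2)"
    proof -
      assume X: "\<bar>fst \<xi> \<bullet> ?h\<bar> \<le> B * norm ?h" and Y: "\<bar>(snd \<xi> + fst \<xi> \<bullet> e) * (norm ?h)\<^sup>2\<bar> \<le> B * (norm ?h)\<^sup>2"
      have tri: "\<bar>f - 2 * x - y\<bar> \<le> \<bar>f\<bar> + (2 * \<bar>x\<bar> + \<bar>y\<bar>)" for f x y :: real by linarith
      have "snd \<xi> - fst \<xi> \<bullet> e = ?f - 2 * (fst \<xi> \<bullet> ?h) - (snd \<xi> + fst \<xi> \<bullet> e) * (norm ?h)\<^sup>2"
        by (simp add: cone_phase_def)
      then have "a \<le> \<bar>?f\<bar> + (2 * \<bar>fst \<xi> \<bullet> ?h\<bar> + \<bar>(snd \<xi> + fst \<xi> \<bullet> e) * (norm ?h)\<^sup>2\<bar>)"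
        using a(2) tri[of ?f "fst \<xi> \<bullet> ?h" "(snd \<xi> + fst \<xi> \<bullet> e) * (norm ?h)\<^sup>2"] by simp
      also have "\<dots> \<le> \<bar>?f\<bar> + (2 * (B * norm ?h) + B * (norm ?h)\<^sup>2)"
        by (intro add_mono mult_left_mono X Y order_refl) simp
      finally show "a \<le> \<bar>?f\<bar> + B * (2 * norm ?h + (norm ?h)\<^sup>2)" by (simp add: algebra_simps)
    qed
    also have "B * (2 * norm ?h + (norm ?h)\<^sup>2) \<le> B * (2 * (1 + (norm p)\<^sup>2))"
    proof (rule mult_left_mono[OF _ B0])
      have "0 \<le> (norm ?h - 1)\<^sup>2" by simp
      then have "2 * norm ?h \<le> 1 + (norm ?h)\<^sup>2" by (simp add: power2_eq_square algebra_simps)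
      moreover have "(norm ?h)\<^sup>2 \<le> (norm p)\<^sup>2" by (intro power_mono norm_horizontal_le e) simp
      ultimately show "2 * norm ?h + (norm ?h)\<^sup>2 \<le> 2 * (1 + (norm p)\<^sup>2)"
        unfolding distrib_left using zero_le_power2[of "norm p"] by linarith
    qed
    \<comment> \<open>In the second alternative \<open>4 * B / a * (1 + (norm p)\<^sup>2)\<close> is
      at least 1, so its power dominates the trivial bound 1 on the integrand.\<close>
    finally have "a / 2 \<le> \<bar>?f\<bar> \<or> a / 2 \<le> B * (2 * (1 + (norm p)\<^sup>2))" by linarith
    then show ?thesis
    proof
      assume "a / 2 \<le> \<bar>?f\<bar>"
      then have "a / 2 \<le> norm ?z" using z by linarith
      then have "1 / norm ?z \<le> 1 / (a / 2)" using a(1) by (intro frac_le) auto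
      then have "(1 / norm ?z) ^ Suc k \<le> (2 / a) ^ Suc k" by (intro power_mono) auto
      moreover have "0 \<le> (4 * B / a) ^ Suc k * (1 + (norm p)\<^sup>2) ^ Suc k"
        using B0 a(1) by (intro mult_nonneg_nonneg zero_le_power) auto
      ultimately show ?thesis unfolding nz by (rule add_increasing2[rotated])
    next
      assume "a / 2 \<le> B * (2 * (1 + (norm p)\<^sup>2))"
      then have "1 \<le> 4 * B / a * (1 + (norm p)\<^sup>2)" using a(1) by (simp add: field_simps)
      then have "1 \<le> (4 * B / a) ^ Suc k * (1 + (norm p)\<^sup>2) ^ Suc k"
        unfolding power_mult_distrib[symmetric] by (rule one_le_power)
      moreover have "(1 / norm ?z) ^ Suc k \<le> 1"
      proof (rule power_le_one)
        show "1 / norm ?z \<le> 1" using frac_le[of 1 1 1 "norm ?z"] z(1) by simp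
      qed simp
      ultimately have "(1 / norm ?z) ^ Suc k \<le> (4 * B / a) ^ Suc k * (1 + (norm p)\<^sup>2) ^ Suc k"
        by (rule order_trans[rotated])
      then show ?thesis unfolding nz by (rule add_increasing[rotated]) (use a(1) in \<open>intro zero_le_power; simp\<close>)
    qed
  qed
  have "norm (fourier_transform (cone_measure e k) \<xi>) \<le> (LINT p|(gauss :: 'a measure). (2 / a) ^ Suc k + (4 * B / a) ^ Suc k * (1 + (norm p)\<^sup>2) ^ Suc k)"
    unfolding fourier_transform_cone_measure(2)
    by (intro norm_integral_le le Bochner_Integration.integrable_add integrable_mult_right integrable_gauss_polynomial_weight) simp
  also have "\<dots> = (2 / a) ^ Suc k + (4 * B / a) ^ Suc k * ?G"
  proof -
    have "integrable gauss (\<lambda>p :: 'a. (4 * B / a) ^ Suc k * (1 + (norm p)\<^sup>2) ^ Suc k)"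
      by (intro integrable_mult_right integrable_gauss_polynomial_weight)
    then show ?thesis
      unfolding Bochner_Integration.integral_add[OF g.integrable_const] integral_mult_right_zero
      by (simp add: g.prob_space[simplified] del: power_Suc)
  qed
  finally show "norm (fourier_transform (cone_measure e k) \<xi>) \<le> (2 / a) ^ Suc k + (4 * B / a) ^ Suc k * ?G" .
qed

section \<open>The Fourier dimension of the cone\<close>

text \<open>Frequencies of norm \<open>N > 1\<close> are split at the threshold
  \<open>B = N powr \<theta> / 4\<close>. A linear or quadratic coefficient above it gives
  \<open>B powr (- q / 2)\<close> by curvature; otherwise the constant coefficient is at least
  \<open>N / 2\<close>, and a high power of \<open>B / N\<close> decays as fast as required.\<close>

lemma light_cone_measure_with_decay:
  assumes s: "0 \<le> s" "s < real DIM('a) - 1"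
  obtains \<mu> C where "\<mu> \<in> borel_prob_on (light_cone :: ('a::euclidean_space \<times> real) set)" "0 < C"
    "\<And>\<xi>. \<xi> \<noteq> 0 \<Longrightarrow> norm (fourier_transform \<mu> \<xi>) \<le> C * norm \<xi> powr (- s / 2)"
proof -
  obtain e :: 'a where e: "e \<in> Basis" using nonempty_Basis by blast
  define q where "q = DIM('a) - 1"
  have q: "real q = real DIM('a) - 1" by (simp add: q_def of_nat_diff Suc_leI)
  \<comment> \<open>Chosen so that \<open>B powr (- q / 2)\<close> is of order
    \<open>N powr (- s / 2)\<close>; \<open>\<theta> < 1\<close> because \<open>s\<close> is
    strictly below \<open>q\<close>.\<close>
  define \<theta> where "\<theta> = s / real q"
  have q0: "0 < real q" using s q by simp
  then have \<theta>: "0 \<le> \<theta>" "\<theta> < 1" "\<theta> * real q = s" using s q by (auto simp: \<theta>_def)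
  \<comment> \<open>At least \<open>q\<close> for the curvature bound, and large enough that
    \<open>(\<theta> - 1) * real (Suc k) \<le> - s / 2\<close>.\<close>
  define k where "k = q + nat \<lceil>s / (2 * (1 - \<theta>))\<rceil>"
  have k1: "s / 2 \<le> real (Suc k)" using s q by (simp add: k_def)
  have k2: "s / 2 \<le> (1 - \<theta>) * real (Suc k)"
  proof -
    have "s / (2 * (1 - \<theta>)) \<le> real (nat \<lceil>s / (2 * (1 - \<theta>))\<rceil>)" by (rule real_nat_ceiling_ge)
    also have "\<dots> \<le> real (Suc k)" by (simp add: k_def)
    finally show ?thesis using \<theta> by (simp add: field_simps)
  qed
  let ?\<mu> = "cone_measure e k"
  have \<mu>: "?\<mu> \<in> borel_prob_on light_cone" by (rule cone_measure_in_borel_prob_on[OF e])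
  then have P\<mu>: "prob_space ?\<mu>" unfolding borel_prob_on_def by blast
  obtain C where C: "0 < C" "\<And>\<xi> B. 0 < B \<Longrightarrow> B \<le> norm (horizontal e (fst \<xi>)) \<or> B \<le> \<bar>snd \<xi> + fst \<xi> \<bullet> e\<bar>
      \<Longrightarrow> norm (fourier_transform ?\<mu> \<xi>) \<le> C / sqrt B ^ q"
    using fourier_transform_cone_measure_curvature[OF e q_def, of k] by (auto simp: k_def)
  obtain G where G: "0 \<le> G" "\<And>\<xi> a B. 0 < a \<Longrightarrow> a \<le> \<bar>snd \<xi> - fst \<xi> \<bullet> e\<bar> \<Longrightarrow> norm (horizontal e (fst \<xi>)) \<le> B
      \<Longrightarrow> \<bar>snd \<xi> + fst \<xi> \<bullet> e\<bar> \<le> B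
      \<Longrightarrow> norm (fourier_transform ?\<mu> \<xi>) \<le> (2 / a) ^ Suc k + (4 * B / a) ^ Suc k * G"
    using fourier_transform_cone_measure_nonstationary[OF e] by blast
  define K where "K = 1 + C * 2 ^ q + 4 ^ Suc k + 2 ^ Suc k * G"
  have K: "1 \<le> K" "C * 2 ^ q \<le> K" "4 ^ Suc k + 2 ^ Suc k * G \<le> K"
    using C(1) G(1) by (auto simp: K_def add_nonneg_nonneg)
  show ?thesis
  proof (rule that[OF \<mu>, of K])
    show "0 < K" using K by simp
    fix \<xi> :: "'a \<times> real" assume "\<xi> \<noteq> 0"
    define N where "N = norm \<xi>"
    have N0: "0 < N" using \<open>\<xi> \<noteq> 0\<close> by (simp add: N_def)
    \<comment> \<open>The factor 4 gives \<open>2 * B \<le> N / 2\<close> when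
      \<open>N \<ge> 1\<close>, so that two coefficients below \<open>B\<close> force the constant
      one to be at least \<open>N / 2\<close>.\<close>
    define B where "B = N powr \<theta> / 4"
    have "norm (fourier_transform ?\<mu> \<xi>) \<le> K * N powr (- s / 2)"
    proof (cases "N \<le> 1")
      case True
      have "norm (fourier_transform ?\<mu> \<xi>) \<le> 1 * 1" using norm_fourier_transform_le_1[OF P\<mu>] by simp
      also have "\<dots> \<le> K * N powr (- s / 2)"
        using True N0 K s powr_mono2'[of "- s / 2" N 1] by (intro mult_mono) auto
      finally show ?thesis .
    next
      case False
      then have N1: "1 \<le> N" by simp
      have B0: "0 < B" using N0 by (simp add: B_def)
      show ?thesis
      proof (cases "B \<le> norm (horizontal e (fst \<xi>)) \<or> B \<le> \<bar>snd \<xi> + fst \<xi> \<bullet> e\<bar>")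
        case True
        have B_pow: "sqrt B ^ q = N powr (s / 2) / 2 ^ q"
        proof -
          have "sqrt B = N powr (\<theta> / 2) / 2"
            using N0 by (simp add: B_def real_sqrt_divide powr_half_sqrt[symmetric] powr_powr)
          then have "sqrt B ^ q = (N powr (\<theta> / 2)) ^ q / 2 ^ q" by (simp only: power_divide)
          also have "(N powr (\<theta> / 2)) ^ q = N powr (s / 2)"
            using N0 \<theta>(3) by (simp add: powr_realpow[symmetric] powr_powr)
          finally show ?thesis .
        qed
        have "C / sqrt B ^ q = C * 2 ^ q * N powr (- s / 2)"
          unfolding B_pow using N0 by (simp add: powr_minus divide_simps)
        moreover have "C * 2 ^ q * N powr (- s / 2) \<le> K * N powr (- s / 2)"
          using K by (intro mult_right_mono) auto
        ultimately show ?thesis using C(2)[OF B0 True] by linarith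
      next
        case False
        let ?x = "fst \<xi> \<bullet> e" and ?t = "snd \<xi>"
        have "N \<le> norm (fst \<xi>) + \<bar>?t\<bar>"
          using norm_Pair_le[of "fst \<xi>" ?t] by (simp add: N_def)
        also have "norm (fst \<xi>) \<le> norm (horizontal e (fst \<xi>)) + \<bar>?x\<bar>"
          using norm_triangle_ineq[of "horizontal e (fst \<xi>)" "?x *\<^sub>R e"] e by (simp add: horizontal_def)
        finally have "N \<le> 2 * B + \<bar>?t - ?x\<bar>"
          using False by linarith
        moreover have "4 * B \<le> N"
          using powr_mono[of \<theta> 1 N] \<theta> N1 by (simp add: B_def)
        ultimately have a: "N / 2 \<le> \<bar>?t - ?x\<bar>" by linarith
        have "norm (fourier_transform ?\<mu> \<xi>) \<le> (2 / (N / 2)) ^ Suc k + (4 * B / (N / 2)) ^ Suc k * G"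
          using a N0 False by (intro G(2)) auto
        also have "\<dots> \<le> 4 ^ Suc k * N powr (- s / 2) + 2 ^ Suc k * N powr (- s / 2) * G"
        proof (intro add_mono mult_right_mono G(1))
          have "(2 / (N / 2)) ^ Suc k = 4 ^ Suc k * (1 / N ^ Suc k)"
            by (simp add: power_divide del: power_Suc)
          also have "1 / N ^ Suc k = N powr (- real (Suc k))"
            using N0 by (simp only: powr_minus_divide powr_realpow)
          also have "4 ^ Suc k * N powr (- real (Suc k)) \<le> 4 ^ Suc k * N powr (- s / 2)"
            using N1 k1 by (intro mult_left_mono powr_mono) auto
          finally show "(2 / (N / 2)) ^ Suc k \<le> 4 ^ Suc k * N powr (- s / 2)" .
          have "4 * B / (N / 2) = 2 * N powr (\<theta> - 1)"
            using N0 by (simp add: B_def powr_diff)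
          then have "(4 * B / (N / 2)) ^ Suc k = 2 ^ Suc k * (N powr (\<theta> - 1)) ^ Suc k"
            by (simp only: power_mult_distrib)
          also have "(N powr (\<theta> - 1)) ^ Suc k = N powr ((\<theta> - 1) * real (Suc k))"
            using N0 by (subst powr_power) (auto simp: mult.commute)
          also have "2 ^ Suc k * N powr ((\<theta> - 1) * real (Suc k)) \<le> 2 ^ Suc k * N powr (- s / 2)"
            using N1 k2 by (intro mult_left_mono powr_mono) (auto simp: algebra_simps)
          finally show "(4 * B / (N / 2)) ^ Suc k \<le> 2 ^ Suc k * N powr (- s / 2)" .
        qed
        also have "\<dots> = (4 ^ Suc k + 2 ^ Suc k * G) * N powr (- s / 2)" by (simp add: algebra_simps)
        also have "\<dots> \<le> K * N powr (- s / 2)" using K by (intro mult_right_mono) auto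
        finally show ?thesis .
      qed
    qed
    then show "norm (fourier_transform ?\<mu> \<xi>) \<le> K * norm \<xi> powr (- s / 2)" by (simp add: N_def)
  qed
qed

text \<open>The type \<open>'a\<close> stands for the space of the first \<open>d = DIM('a)\<close>
  coordinates; \<open>d \<ge> 1\<close> holds for every Euclidean space type.\<close>

theorem mainTheorem1:
  shows "fourier_dim (light_cone :: ('a::euclidean_space \<times> real) set) = real DIM('a) - 1"
proof -
  define S where "S = {s. 0 \<le> s \<and> s \<le> real DIM('a \<times> real) \<and>
     (\<exists>M \<in> borel_prob_on (light_cone :: ('a \<times> real) set). \<exists>C>0. \<forall>\<xi>. \<xi> \<noteq> 0 \<longrightarrow>
        norm (fourier_transform M \<xi>) \<le> C * norm \<xi> powr (- s / 2))}"
  have d: "1 \<le> real DIM('a)" by (simp add: Suc_leI)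
  have upper: "s \<le> real DIM('a) - 1" if "s \<in> S" for s
    using that light_cone_fourier_decay_le unfolding S_def by blast
  have lower: "s \<in> S" if s: "0 \<le> s" "s < real DIM('a) - 1" for s
  proof -
    obtain \<mu> C where "\<mu> \<in> borel_prob_on (light_cone :: ('a \<times> real) set)" "0 < C"
      "\<And>\<xi>. \<xi> \<noteq> 0 \<Longrightarrow> norm (fourier_transform \<mu> \<xi>) \<le> C * norm \<xi> powr (- s / 2)"
      using light_cone_measure_with_decay[OF s] by blast
    with s show ?thesis unfolding S_def by auto
  qed
  \<comment> \<open>If \<open>DIM('a) = 1\<close> then \<open>lower\<close> is vacuous, so
    membership of 0 is shown separately: the transform of any probability measure is bounded by
    1.\<close>
  have zero: "0 \<in> S"
  proof -
    obtain e :: 'a where e: "e \<in> Basis" using nonempty_Basis by blast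
    note M = cone_measure_in_borel_prob_on[OF e, of 0]
    then have "norm (fourier_transform (cone_measure e 0) \<xi>) \<le> 1 * norm \<xi> powr (- 0 / 2)" if "\<xi> \<noteq> 0" for \<xi>
      using that norm_fourier_transform_le_1[of "cone_measure e 0" \<xi>] by (simp add: borel_prob_on_def)
    with M show ?thesis unfolding S_def by (auto intro!: bexI[OF _ M] exI[of _ "1::real"])
  qed
  have bdd: "bdd_above S" using upper by (rule bdd_aboveI)
  have "Sup S = real DIM('a) - 1"
  proof (rule antisym)
    show "Sup S \<le> real DIM('a) - 1" using zero upper by (intro cSup_least) auto
    show "real DIM('a) - 1 \<le> Sup S"
    \<comment> \<open>The constructed measures reach every exponent strictly below
      \<open>real DIM('a) - 1\<close>, which determines the supremum whether or not it is
      attained.\<close>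
    proof (rule dense_le)
      fix s assume s: "s < real DIM('a) - 1"
      show "s \<le> Sup S"
      proof (cases "0 \<le> s")
        case True
        then show ?thesis using s by (intro cSup_upper lower bdd)
      next
        case False
        then show ?thesis using cSup_upper[OF zero bdd] by simp
      qed
    qed
  qed
  then show ?thesis unfolding fourier_dim_def S_def .
qed

end
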